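(* Let $L$ be a modular lattice of finite length. Then: (i) $Con(L)$ is a Boolean lattice of length $s(L)$. (ii) If $\theta_1,\dots,\theta_{s(L)}$ are the co-atoms of $Con(L)$ (so that the lattices $L/\theta_i$ are the subdirectly irreducible factors of $L$), then $\delta(L)=\sum_{i=1}^{s(L)}\delta(L/\theta_i)$. (iii) For each projectivity class $\mathcal{P}$ of coverings of $L$, all maximal chains from $0$ to $1$ in $L$ have the same number of coverings belonging to $\mathcal{P}$.
   Context: A lattice has finite length if the cardinalities of all its chains are bounded by a universal constant; $\delta(L)$ denotes the length of a longest chain of $L$, where a chain with $t+1$ elements has length $t$. Joins are written $x+y$, meets $xy$; $x\prec y$ means that $y$ covers $x$. A covering $(a,b)$ is a two-element interval $[a,b]$, i.e. $a\prec b$; $Cov(L)$ is the set of all coverings of $L$. Intervals $[a,b]$ and $[c,d]$ are transposed if ($a=bc$ and $d=b+c$) or ($c=ad$ and $b=a+d$). Consider the graph with vertex set $Cov(L)$ in which two coverings are adjacent iff they are transposed. For modular $L$ (where intervals transposed to coverings are again coverings) its connected components are called the projectivity classes of coverings, and $s(L)$ denotes their number. A maximal chain $0=x_0\prec x_1\prec\cdots\prec x_n=1$ has the coverings $(x_{i-1},x_i)$, $1\le i\le n$. $Con(L)$ is the lattice of all congruence relations of $L$. A Boolean lattice is a complemented distributive lattice. *)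

theory Defs
  imports "HOL-Algebra.Lattice" "HOL-Library.FuncSet"
begin

section \<open>Modular and Boolean lattices\<close>

locale modular_lattice = lattice +
  assumes modular_law:
    "\<lbrakk>x \<in> carrier L; y \<in> carrier L; z \<in> carrier L; x \<sqsubseteq> z\<rbrakk>
      \<Longrightarrow> x \<squnion> (y \<sqinter> z) = (x \<squnion> y) \<sqinter> z"

locale boolean_lattice = bounded_lattice +
  assumes distributive_law:
    "\<lbrakk>x \<in> carrier L; y \<in> carrier L; z \<in> carrier L\<rbrakk>
      \<Longrightarrow> x \<sqinter> (y \<squnion> z) = (x \<sqinter> y) \<squnion> (x \<sqinter> z)"
  and complement_exists:
    "x \<in> carrier L \<Longrightarrow> \<exists>y\<in>carrier L. x \<sqinter> y = \<bottom> \<and> x \<squnion> y = \<top>"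


section \<open>Chains and length\<close>

definition is_chain :: "('a, 'm) gorder_scheme \<Rightarrow> 'a set \<Rightarrow> bool" where
  "is_chain L C \<longleftrightarrow>
     C \<subseteq> carrier L \<and> (\<forall>x\<in>C. \<forall>y\<in>C. x \<sqsubseteq>\<^bsub>L\<^esub> y \<or> y \<sqsubseteq>\<^bsub>L\<^esub> x)"

definition finite_length :: "('a, 'm) gorder_scheme \<Rightarrow> bool" where
  "finite_length L \<longleftrightarrow> (\<exists>n. \<forall>C. is_chain L C \<longrightarrow> finite C \<and> card C \<le> n)"

text \<open>Meaningful only if \<^const>\<open>finite_length\<close> holds and the carrier is nonempty;
  otherwise the maximum is over an unbounded or empty set.\<close>

definition lat_length :: "('a, 'm) gorder_scheme \<Rightarrow> nat" where
  "lat_length L = Max {t. \<exists>C. is_chain L C \<and> card C = t + 1}"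


section \<open>Coverings and projectivity classes\<close>

definition covered_by :: "('a, 'm) gorder_scheme \<Rightarrow> 'a \<Rightarrow> 'a \<Rightarrow> bool" where
  "covered_by L a b \<longleftrightarrow>
     a \<in> carrier L \<and> b \<in> carrier L \<and> a \<sqsubset>\<^bsub>L\<^esub> b \<and>
     \<not> (\<exists>c\<in>carrier L. a \<sqsubset>\<^bsub>L\<^esub> c \<and> c \<sqsubset>\<^bsub>L\<^esub> b)"

definition Cov :: "('a, 'm) gorder_scheme \<Rightarrow> ('a \<times> 'a) set" where
  "Cov L = {(a, b). covered_by L a b}"

fun transposed :: "('a, 'm) gorder_scheme \<Rightarrow> 'a \<times> 'a \<Rightarrow> 'a \<times> 'a \<Rightarrow> bool" where
  "transposed L (a, b) (c, d) \<longleftrightarrow>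
     (a = b \<sqinter>\<^bsub>L\<^esub> c \<and> d = b \<squnion>\<^bsub>L\<^esub> c) \<or> (c = a \<sqinter>\<^bsub>L\<^esub> d \<and> b = a \<squnion>\<^bsub>L\<^esub> d)"

definition transposition_graph ::
  "('a, 'm) gorder_scheme \<Rightarrow> (('a \<times> 'a) \<times> ('a \<times> 'a)) set" where
  "transposition_graph L = {(p, q). p \<in> Cov L \<and> q \<in> Cov L \<and> transposed L p q}"

text \<open>The adjacency relation is symmetric, so its connected components are the classes of
  its reflexive transitive closure.\<close>

definition proj_classes :: "('a, 'm) gorder_scheme \<Rightarrow> ('a \<times> 'a) set set" where
  "proj_classes L = Cov L // (transposition_graph L)\<^sup>*"

text \<open>A maximal chain from \<open>0\<close> to \<open>1\<close> is given as the list of its elements in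
  increasing order.\<close>

definition is_maximal_chain :: "('a, 'm) gorder_scheme \<Rightarrow> 'a list \<Rightarrow> bool" where
  "is_maximal_chain L xs \<longleftrightarrow>
     xs \<noteq> [] \<and> hd xs = \<bottom>\<^bsub>L\<^esub> \<and> last xs = \<top>\<^bsub>L\<^esub> \<and>
     (\<forall>i. Suc i < length xs \<longrightarrow> covered_by L (xs ! i) (xs ! Suc i))"

definition chain_coverings :: "'a list \<Rightarrow> ('a \<times> 'a) set" where
  "chain_coverings xs = {(xs ! i, xs ! Suc i) | i. Suc i < length xs}"


section \<open>Congruences and quotient lattices\<close>

definition is_congruence :: "('a, 'm) gorder_scheme \<Rightarrow> ('a \<times> 'a) set \<Rightarrow> bool" where
  "is_congruence L \<theta> \<longleftrightarrow> equiv (carrier L) \<theta> \<and>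
     (\<forall>a b c d. (a, b) \<in> \<theta> \<longrightarrow> (c, d) \<in> \<theta> \<longrightarrow>
        (a \<squnion>\<^bsub>L\<^esub> c, b \<squnion>\<^bsub>L\<^esub> d) \<in> \<theta> \<and> (a \<sqinter>\<^bsub>L\<^esub> c, b \<sqinter>\<^bsub>L\<^esub> d) \<in> \<theta>)"

definition Con :: "('a, 'm) gorder_scheme \<Rightarrow> ('a \<times> 'a) set gorder" where
  "Con L = \<lparr>carrier = {\<theta>. is_congruence L \<theta>}, eq = (=), le = (\<subseteq>)\<rparr>"

definition coatoms :: "('a, 'm) gorder_scheme \<Rightarrow> 'a set" where
  "coatoms L = {x. covered_by L x \<top>\<^bsub>L\<^esub>}"

text \<open>The order of \<open>L/\<theta>\<close> is the one belonging to the induced operations: \<open>A \<le> B\<close> iff the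
  class of the meets \<open>ab\<close> (\<open>a \<in> A\<close>, \<open>b \<in> B\<close>) is \<open>A\<close> itself.\<close>

definition quotient_lattice ::
  "('a, 'm) gorder_scheme \<Rightarrow> ('a \<times> 'a) set \<Rightarrow> 'a set gorder" where
  "quotient_lattice L \<theta> =
     \<lparr>carrier = carrier L // \<theta>, eq = (=), le = (\<lambda>A B. \<forall>a\<in>A. \<forall>b\<in>B. a \<sqinter>\<^bsub>L\<^esub> b \<in> A)\<rparr>"

lemma quotient_lattice_operations:
  fixes L (structure)
  assumes "lattice L" and cong: "is_congruence L \<theta>"
  shows "lattice (quotient_lattice L \<theta>)"
    and "\<lbrakk>a \<in> carrier L; b \<in> carrier L\<rbrakk>
      \<Longrightarrow> \<theta> `` {a} \<squnion>\<^bsub>quotient_lattice L \<theta>\<^esub> \<theta> `` {b} = \<theta> `` {a \<squnion> b}"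
    and "\<lbrakk>a \<in> carrier L; b \<in> carrier L\<rbrakk>
      \<Longrightarrow> \<theta> `` {a} \<sqinter>\<^bsub>quotient_lattice L \<theta>\<^esub> \<theta> `` {b} = \<theta> `` {a \<sqinter> b}"
proof -
  interpret lattice L by fact
  let ?Q = "quotient_lattice L \<theta>"
  have eqv: "equiv (carrier L) \<theta>"
    and cj: "\<And>a b c d. (a, b) \<in> \<theta> \<Longrightarrow> (c, d) \<in> \<theta> \<Longrightarrow> (a \<squnion> c, b \<squnion> d) \<in> \<theta>"
    and cm: "\<And>a b c d. (a, b) \<in> \<theta> \<Longrightarrow> (c, d) \<in> \<theta> \<Longrightarrow> (a \<sqinter> c, b \<sqinter> d) \<in> \<theta>"
    using cong by (auto simp: is_congruence_def)
  have refl\<theta>: "\<And>a. a \<in> carrier L \<Longrightarrow> (a, a) \<in> \<theta>" and sym\<theta>: "\<And>a b. (a, b) \<in> \<theta> \<Longrightarrow> (b, a) \<in> \<theta>"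
    and trans\<theta>: "\<And>a b c. (a, b) \<in> \<theta> \<Longrightarrow> (b, c) \<in> \<theta> \<Longrightarrow> (a, c) \<in> \<theta>"
    and sub: "\<And>a b. (a, b) \<in> \<theta> \<Longrightarrow> a \<in> carrier L \<and> b \<in> carrier L"
    using eqv by (auto simp: equiv_def refl_on_def dest: symD transD)
  have cl: "carrier ?Q = (\<lambda>a. \<theta> `` {a}) ` carrier L"
    by (auto simp: quotient_lattice_def quotient_def)
  have eq: "(.=\<^bsub>?Q\<^esub>) = (=)" by (simp add: quotient_lattice_def)
  have cls: "\<theta> `` {a} = \<theta> `` {b} \<longleftrightarrow> (a, b) \<in> \<theta>" if "a \<in> carrier L" "b \<in> carrier L" for a b
    using eq_equiv_class_iff[OF eqv] that by blast
  have le: "\<theta> `` {a} \<sqsubseteq>\<^bsub>?Q\<^esub> \<theta> `` {b} \<longleftrightarrow> (a \<sqinter> b, a) \<in> \<theta>"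
    if "a \<in> carrier L" "b \<in> carrier L" for a b
  proof
    assume "\<theta> `` {a} \<sqsubseteq>\<^bsub>?Q\<^esub> \<theta> `` {b}"
    then show "(a \<sqinter> b, a) \<in> \<theta>"
      using that refl\<theta> sym\<theta> by (auto simp: quotient_lattice_def)
  next
    assume *: "(a \<sqinter> b, a) \<in> \<theta>"
    then show "\<theta> `` {a} \<sqsubseteq>\<^bsub>?Q\<^esub> \<theta> `` {b}"
      using trans\<theta>[OF sym\<theta>[OF *] cm] by (simp add: quotient_lattice_def)
  qed
  have absorb_jm: "(a \<squnion> b) \<sqinter> b = b" "a \<sqinter> (a \<squnion> b) = a" "(a \<sqinter> b) \<squnion> b = b"
    "a \<squnion> (a \<sqinter> b) = a"
    if "a \<in> carrier L" "b \<in> carrier L" for a b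
    using that le_iff_join[OF that(2) join_closed[OF that]] join_right[OF that]
      le_iff_join[OF that(1) join_closed[OF that]] join_left[OF that]
      le_iff_meet[OF meet_closed[OF that] that(2)] meet_right[OF that]
      le_iff_meet[OF meet_closed[OF that] that(1)] meet_left[OF that]
      meet_comm[of L "a \<squnion> b" b] join_comm[of L "a \<sqinter> b" a]
    by simp_all
  have assoc: "(a \<sqinter> b) \<sqinter> c = a \<sqinter> (b \<sqinter> c)" "(a \<squnion> b) \<squnion> c = a \<squnion> (b \<squnion> c)"
    if "a \<in> carrier L" "b \<in> carrier L" "c \<in> carrier L" for a b c
    using weak_meet_assoc[OF that] weak_join_assoc[OF that] by (simp_all add: eq_is_equal)
  have le': "\<theta> `` {a} \<sqsubseteq>\<^bsub>?Q\<^esub> \<theta> `` {b} \<longleftrightarrow> (a \<squnion> b, b) \<in> \<theta>"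
    if ab: "a \<in> carrier L" "b \<in> carrier L" for a b
  proof -
    have "(a \<squnion> b, b) \<in> \<theta>" if *: "(a \<sqinter> b, a) \<in> \<theta>"
      using cj[OF * refl\<theta>[OF ab(2)]] absorb_jm(3)[OF ab] sym\<theta> by simp
    moreover have "(a \<sqinter> b, a) \<in> \<theta>" if *: "(a \<squnion> b, b) \<in> \<theta>"
      using cm[OF refl\<theta>[OF ab(1)] *] absorb_jm(2)[OF ab] sym\<theta> by simp
    ultimately show ?thesis using le[OF ab] by blast
  qed
  have po: "partial_order ?Q"
  proof (unfold_locales, unfold eq)
    fix X Y Z
    assume X: "X \<in> carrier ?Q" and Y: "Y \<in> carrier ?Q" and Z: "Z \<in> carrier ?Q"
    obtain a b c where abc: "X = \<theta> `` {a}" "a \<in> carrier L" "Y = \<theta> `` {b}" "b \<in> carrier L"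
      "Z = \<theta> `` {c}" "c \<in> carrier L" using X Y Z by (auto simp: cl)
    assume "X \<sqsubseteq>\<^bsub>?Q\<^esub> Y" "Y \<sqsubseteq>\<^bsub>?Q\<^esub> Z"
    then have 1: "(a \<sqinter> b, a) \<in> \<theta>" and 2: "(b \<sqinter> c, b) \<in> \<theta>" using le abc by auto
    have 3: "((a \<sqinter> b) \<sqinter> c, a \<sqinter> c) \<in> \<theta>" by (rule cm[OF 1 refl\<theta>]) fact
    have 4: "(a \<sqinter> (b \<sqinter> c), a \<sqinter> b) \<in> \<theta>" by (rule cm[OF refl\<theta> 2]) fact
    have 5: "(a \<sqinter> b) \<sqinter> c = a \<sqinter> (b \<sqinter> c)" using assoc abc by auto
    have "(a \<sqinter> c, a) \<in> \<theta>" by (rule trans\<theta>[OF sym\<theta>[OF 3[unfolded 5]] trans\<theta>[OF 4 1]])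
    then show "X \<sqsubseteq>\<^bsub>?Q\<^esub> Z" using le abc by auto
  next
    fix X Y
    assume "X \<in> carrier ?Q" and "Y \<in> carrier ?Q"
    then obtain a b where ab: "X = \<theta> `` {a}" "a \<in> carrier L" "Y = \<theta> `` {b}" "b \<in> carrier L"
      by (auto simp: cl)
    assume "X \<sqsubseteq>\<^bsub>?Q\<^esub> Y" "Y \<sqsubseteq>\<^bsub>?Q\<^esub> X"
    then have 1: "(a \<sqinter> b, a) \<in> \<theta>" and 2: "(a \<sqinter> b, b) \<in> \<theta>"
      using le ab meet_comm[of L b a] by auto
    have "(a, b) \<in> \<theta>" by (rule trans\<theta>[OF sym\<theta>[OF 1] 2])
    then show "X = Y" using cls ab by auto
  next
    fix X assume "X \<in> carrier ?Q"
    then obtain a where a: "X = \<theta> `` {a}" "a \<in> carrier L" by (auto simp: cl)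
    then show "X \<sqsubseteq>\<^bsub>?Q\<^esub> X" using le'[of a a] refl\<theta> le_iff_meet[of a a]
      by simp
  qed auto
  then interpret Q: partial_order ?Q .
  have lub: "least ?Q (\<theta> `` {a \<squnion> b}) (Upper ?Q {\<theta> `` {a}, \<theta> `` {b}})"
    if ab: "a \<in> carrier L" "b \<in> carrier L" for a b
  proof (rule least_UpperI)
    show "{\<theta> `` {a}, \<theta> `` {b}} \<subseteq> carrier ?Q" "\<theta> `` {a \<squnion> b} \<in> carrier ?Q"
      using ab by (auto simp: cl)
  next
    fix X assume "X \<in> {\<theta> `` {a}, \<theta> `` {b}}"
    then show "X \<sqsubseteq>\<^bsub>?Q\<^esub> \<theta> `` {a \<squnion> b}"
      using ab le[of a "a \<squnion> b"] le[of b "a \<squnion> b"] absorb_jm[of a b] refl\<theta> meet_comm[of L b "a \<squnion> b"]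
      by auto
  next
    fix X assume X: "X \<in> Upper ?Q {\<theta> `` {a}, \<theta> `` {b}}"
    then obtain c where c: "X = \<theta> `` {c}" "c \<in> carrier L" by (auto simp: Upper_def cl)
    have "\<theta> `` {a} \<sqsubseteq>\<^bsub>?Q\<^esub> X" "\<theta> `` {b} \<sqsubseteq>\<^bsub>?Q\<^esub> X" using X ab by (auto simp: Upper_def cl)
    then have 1: "(a \<squnion> c, c) \<in> \<theta>" and 2: "(b \<squnion> c, c) \<in> \<theta>" using le' c ab by auto
    have 3: "(a \<squnion> (b \<squnion> c), a \<squnion> c) \<in> \<theta>" by (rule cj[OF refl\<theta> 2]) fact
    have "((a \<squnion> b) \<squnion> c, c) \<in> \<theta>" using trans\<theta>[OF 3 1] assoc ab c by simp
    then show "\<theta> `` {a \<squnion> b} \<sqsubseteq>\<^bsub>?Q\<^esub> X" using le' c ab by auto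
  qed
  have glb: "greatest ?Q (\<theta> `` {a \<sqinter> b}) (Lower ?Q {\<theta> `` {a}, \<theta> `` {b}})"
    if ab: "a \<in> carrier L" "b \<in> carrier L" for a b
  proof (rule greatest_LowerI)
    show "{\<theta> `` {a}, \<theta> `` {b}} \<subseteq> carrier ?Q" "\<theta> `` {a \<sqinter> b} \<in> carrier ?Q"
      using ab by (auto simp: cl)
  next
    fix X assume "X \<in> {\<theta> `` {a}, \<theta> `` {b}}"
    then show "\<theta> `` {a \<sqinter> b} \<sqsubseteq>\<^bsub>?Q\<^esub> X"
      using ab le'[of "a \<sqinter> b" a] le'[of "a \<sqinter> b" b] absorb_jm(3)[of a b] absorb_jm(3)[of b a] refl\<theta>
        meet_comm[of L a b]
      by auto
  next
    fix X assume X: "X \<in> Lower ?Q {\<theta> `` {a}, \<theta> `` {b}}"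
    then obtain c where c: "X = \<theta> `` {c}" "c \<in> carrier L" by (auto simp: Lower_def cl)
    have "X \<sqsubseteq>\<^bsub>?Q\<^esub> \<theta> `` {a}" "X \<sqsubseteq>\<^bsub>?Q\<^esub> \<theta> `` {b}" using X ab by (auto simp: Lower_def cl)
    then have 1: "(c \<sqinter> a, c) \<in> \<theta>" and 2: "(c \<sqinter> b, c) \<in> \<theta>" using le c ab by auto
    have 3: "((c \<sqinter> a) \<sqinter> b, c \<sqinter> b) \<in> \<theta>" by (rule cm[OF 1 refl\<theta>]) fact
    have "(c \<sqinter> (a \<sqinter> b), c) \<in> \<theta>" using trans\<theta>[OF 3 2] assoc ab c by simp
    then show "X \<sqsubseteq>\<^bsub>?Q\<^esub> \<theta> `` {a \<sqinter> b}" using le c ab by auto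
  qed
  show "lattice ?Q"
    by (unfold_locales; unfold cl; use lub glb in blast)
  then interpret Q: lattice ?Q .
  show "\<theta> `` {a} \<squnion>\<^bsub>?Q\<^esub> \<theta> `` {b} = \<theta> `` {a \<squnion> b}" if "a \<in> carrier L" "b \<in> carrier L"
    unfolding join_def[of ?Q] sup_def[of ?Q]
    by (rule some_equality, rule lub[OF that], erule Q.least_unique, rule lub[OF that])
  show "\<theta> `` {a} \<sqinter>\<^bsub>?Q\<^esub> \<theta> `` {b} = \<theta> `` {a \<sqinter> b}" if "a \<in> carrier L" "b \<in> carrier L"
    unfolding meet_def[of ?Q] inf_def[of ?Q]
    by (rule some_equality, rule glb[OF that], erule Q.greatest_unique, rule glb[OF that])
qed


section \<open>Subdirect representations\<close>

definition product_lattice ::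
  "'i set \<Rightarrow> ('i \<Rightarrow> ('b, 'm) gorder_scheme) \<Rightarrow> ('i \<Rightarrow> 'b) gorder" where
  "product_lattice I M =
     \<lparr>carrier = (\<Pi>\<^sub>E i\<in>I. carrier (M i)), eq = (=), le = (\<lambda>f g. \<forall>i\<in>I. f i \<sqsubseteq>\<^bsub>M i\<^esub> g i)\<rparr>"

definition subdirect_embedding ::
  "('a, 'm) gorder_scheme \<Rightarrow> 'i set \<Rightarrow> ('i \<Rightarrow> ('b, 'n) gorder_scheme) \<Rightarrow> ('a \<Rightarrow> 'i \<Rightarrow> 'b) \<Rightarrow> bool"
  where
  "subdirect_embedding L I M f \<longleftrightarrow>
     f \<in> carrier L \<rightarrow> carrier (product_lattice I M) \<and>
     inj_on f (carrier L) \<and>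
     join_pres L (product_lattice I M) f \<and> meet_pres L (product_lattice I M) f \<and>
     (\<forall>i\<in>I. (\<lambda>x. f x i) ` carrier L = carrier (M i))"

text \<open>There is a least congruence (the monolith) above the identity congruence and different
  from it. In particular one-element lattices are not subdirectly irreducible.\<close>

definition subdirectly_irreducible :: "('a, 'm) gorder_scheme \<Rightarrow> bool" where
  "subdirectly_irreducible L \<longleftrightarrow> lattice L \<and>
     (\<exists>\<mu>. least (Con L) \<mu> (carrier (Con L) - {Id_on (carrier L)}))"

end

theory Submission
  imports Defs "HOL-Library.Multiset"
begin

text \<open>Everything rests on one invariant. Going up a maximal chain from \<open>0\<close> to \<open>x\<close>, record the
  projectivity class of every covering that is passed. The multiset \<open>factors x\<close> of these classes
  depends on \<open>x\<close> only: this is the Jordan-Hoelder argument, in which two different lower covers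
  \<open>u\<close>, \<open>v\<close> of \<open>x\<close> give the transposed pairs \<open>(uv, u)\<close>, \<open>(v, x)\<close> and \<open>(uv, v)\<close>, \<open>(u, x)\<close>
  (\<open>composition_factors_unique\<close>). Part (iii) is the case \<open>x = 1\<close>.

  Moving an interval \<open>[xy, y]\<close> up to \<open>[x, x + y]\<close> transposes its coverings, so \<open>factors\<close> is a
  valuation: \<open>factors (x + y) + factors (xy) = factors x + factors y\<close> (\<open>factors_modular\<close>). For a set
  \<open>T\<close> of classes, let \<open>val T x\<close> count the entries of \<open>factors x\<close> that lie in \<open>T\<close>. This is an isotone
  integer valuation, and for such a valuation the pairs \<open>(x, y)\<close> with \<open>val T (xy) = val T (x + y)\<close>
  form a congruence \<open>ker T\<close>. It collapses exactly the coverings whose class is outside \<open>T\<close>.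

  Conversely a congruence collapses with a covering its whole projectivity class, and in finite
  length it is determined by the coverings that it collapses; hence it is \<open>ker T\<close> where \<open>T\<close> consists
  of the classes that it does not collapse (\<open>congruence_eq_ker\<close>). Therefore \<open>S \<mapsto> ker (- S)\<close> is an
  isomorphism from the power set of the finite set of classes onto \<open>Con(L)\<close>. This gives (i) and
  identifies the co-atoms as the congruences \<open>ker {P}\<close>.

  The valuation \<open>val T\<close> induces a strictly increasing function on \<open>L/ker T\<close>, and on a maximal
  chain of \<open>L\<close> it takes every value up to \<open>val T 1\<close>, so \<open>\<delta>(L/ker T) = val T 1\<close>. The
  length of \<open>L\<close> is the total number of entries of \<open>factors 1\<close>, and sorting the entries by their
  class gives the sum in (ii). The intersection of the co-atoms is the identity because \<open>factors\<close>
  is strictly monotone. Finally, a quotient \<open>L/\<theta>\<close> is subdirectly irreducible iff there is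
  a least congruence properly above \<open>\<theta>\<close> (\<open>subdirectly_irreducible_quotient_iff\<close>); for
  \<open>\<theta> = ker T\<close> this asks for a greatest proper subset of \<open>T\<close>, so \<open>T\<close> has exactly one element.\<close>

section \<open>Lengths of orders\<close>

text \<open>A strictly increasing function into \<open>{0..n}\<close> is injective on chains, which bounds their
  cardinality by \<open>n + 1\<close>; a chain on which all values occur attains the bound. Each length in the
  theorem, those of \<open>L\<close>, of its quotients and of \<open>Con(L)\<close>, is computed by this criterion.\<close>

lemma lat_length_eqI:
  fixes K (structure) and h :: "'k \<Rightarrow> nat"
  assumes mono: "\<And>x y. \<lbrakk>x \<in> carrier K; y \<in> carrier K; x \<sqsubseteq> y; x \<noteq> y\<rbrakk> \<Longrightarrow> h x < h y"
    and bound: "\<And>x. x \<in> carrier K \<Longrightarrow> h x \<le> n"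
    and C: "is_chain K C" "h ` C = {..n}"
  shows "finite_length K" and "lat_length K = n"
proof -
  have inj: "inj_on h D" if "is_chain K D" for D
  proof (rule inj_onI, rule ccontr)
    fix x y assume "x \<in> D" "y \<in> D" "h x = h y" "x \<noteq> y"
    moreover from this that have "x \<sqsubseteq> y \<or> y \<sqsubseteq> x" "x \<in> carrier K" "y \<in> carrier K"
      by (auto simp: is_chain_def)
    ultimately show False using mono[of x y] mono[of y x] by auto
  qed
  have le: "finite D \<and> card D \<le> n + 1" if D: "is_chain K D" for D
  proof -
    have "h ` D \<subseteq> {..n}" using bound D by (auto simp: is_chain_def)
    then show ?thesis
      using inj_on_finite[OF inj[OF D], of "{..n}"] card_inj_on_le[OF inj[OF D], of "{..n}"] by auto
  qed
  show "finite_length K" using le by (auto simp: finite_length_def)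
  have "card C = n + 1" using card_image[OF inj[OF C(1)]] C(2) by simp
  then show "lat_length K = n" unfolding lat_length_def using le C(1)
    by (intro Max_eqI finite_subset[of "{t. \<exists>C. is_chain K C \<and> card C = t + 1}" "{..n}"]) force+
qed

section \<open>Orders isomorphic to a finite power set\<close>

text \<open>The properties of \<open>Con(L)\<close> claimed in (i) are those of a finite power set. They are
  transported along an order isomorphism \<open>\<phi>\<close>; the height function for the length is the cardinality
  of the corresponding subset.\<close>

lemma powerset_isomorphic:
  fixes K (structure)
  assumes fin: "finite X" and eq: "(.=) = (=)"
    and bij: "bij_betw \<phi> (Pow X) (carrier K)"
    and iso: "\<And>S S'. \<lbrakk>S \<subseteq> X; S' \<subseteq> X\<rbrakk> \<Longrightarrow> \<phi> S \<sqsubseteq> \<phi> S' \<longleftrightarrow> S \<subseteq> S'"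
  shows "boolean_lattice K" and "finite_length K" and "lat_length K = card X"
    and "coatoms K = (\<lambda>p. \<phi> (X - {p})) ` X"
proof -
  have car: "\<phi> S \<in> carrier K" if "S \<subseteq> X" for S using bij that by (auto simp: bij_betw_def)
  have ex: "\<exists>S. S \<subseteq> X \<and> x = \<phi> S" if "x \<in> carrier K" for x
    using bij that by (auto simp: bij_betw_def)
  have inj: "\<phi> S = \<phi> S' \<longleftrightarrow> S = S'" if "S \<subseteq> X" "S' \<subseteq> X" for S S'
    using bij that by (auto simp: bij_betw_def inj_on_def)
  interpret partial_order K
  proof (unfold_locales, unfold eq)
    show "\<lbrakk>x \<sqsubseteq> y; y \<sqsubseteq> z; x \<in> carrier K; y \<in> carrier K; z \<in> carrier K\<rbrakk> \<Longrightarrow> x \<sqsubseteq> z" for x y z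
      by (metis ex iso subset_trans)
    show "\<lbrakk>x \<sqsubseteq> y; y \<sqsubseteq> x; x \<in> carrier K; y \<in> carrier K\<rbrakk> \<Longrightarrow> x = y" for x y
      by (metis ex iso subset_antisym)
    show "x \<in> carrier K \<Longrightarrow> x \<sqsubseteq> x" for x by (metis ex iso subset_refl)
  qed auto
  have lub: "least K (\<phi> (S \<union> S')) (Upper K {\<phi> S, \<phi> S'})" if "S \<subseteq> X" "S' \<subseteq> X" for S S'
  proof (rule least_UpperI)
    fix y assume y: "y \<in> Upper K {\<phi> S, \<phi> S'}"
    then obtain R where "R \<subseteq> X" "y = \<phi> R" using ex by (auto simp: Upper_def)
    with y that show "\<phi> (S \<union> S') \<sqsubseteq> y" using car iso by (auto simp: Upper_def)
  qed (use that car iso in auto)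
  have glb: "greatest K (\<phi> (S \<inter> S')) (Lower K {\<phi> S, \<phi> S'})" if "S \<subseteq> X" "S' \<subseteq> X" for S S'
  proof (rule greatest_LowerI)
    fix y assume y: "y \<in> Lower K {\<phi> S, \<phi> S'}"
    then obtain R where "R \<subseteq> X" "y = \<phi> R" using ex by (auto simp: Lower_def)
    with y that show "y \<sqsubseteq> \<phi> (S \<inter> S')"
      using car iso[of R S] iso[of R S'] iso[of R "S \<inter> S'"]
      by (auto simp: Lower_def le_infI1)
  qed (use that car[of S] car[of S'] car[of "S \<inter> S'"] iso[of "S \<inter> S'"] in \<open>auto simp: le_infI1\<close>)
  have bot: "least K (\<phi> {}) (carrier K)" and top: "greatest K (\<phi> X) (carrier K)"
    unfolding least_def greatest_def by (auto simp: car iso dest!: ex)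
  interpret bounded_lattice K
  proof
    fix x y assume "x \<in> carrier K" "y \<in> carrier K"
    then obtain S S' where "x = \<phi> S" "S \<subseteq> X" "y = \<phi> S'" "S' \<subseteq> X" using ex by metis
    then show "\<exists>s. least K s (Upper K {x, y})" "\<exists>s. greatest K s (Lower K {x, y})"
      using lub glb by blast+
  qed (use bot top in blast)+
  have join: "\<phi> S \<squnion> \<phi> S' = \<phi> (S \<union> S')" if "S \<subseteq> X" "S' \<subseteq> X" for S S'
    unfolding join_def by (rule least_unique[OF sup_of_two_least lub]) (use that car in auto)
  have meet: "\<phi> S \<sqinter> \<phi> S' = \<phi> (S \<inter> S')" if "S \<subseteq> X" "S' \<subseteq> X" for S S'
    unfolding meet_def by (rule greatest_unique[OF inf_of_two_greatest glb]) (use that car in auto)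
  have bot_eq: "\<bottom> = \<phi> {}" by (rule least_unique[OF bottom_least bot])
  have top_eq: "\<top> = \<phi> X" by (rule greatest_unique[OF top_greatest top])
  show "boolean_lattice K"
  proof
    fix x y z assume "x \<in> carrier K" "y \<in> carrier K" "z \<in> carrier K"
    then obtain S R Q where "x = \<phi> S" "S \<subseteq> X" "y = \<phi> R" "R \<subseteq> X" "z = \<phi> Q" "Q \<subseteq> X"
      using ex by metis
    moreover have "R \<union> Q \<subseteq> X" "S \<inter> R \<subseteq> X" "S \<inter> Q \<subseteq> X" using calculation by auto
    ultimately show "x \<sqinter> (y \<squnion> z) = (x \<sqinter> y) \<squnion> (x \<sqinter> z)"
      by (simp add: join meet Int_Un_distrib)
  next
    fix x assume "x \<in> carrier K"
    then obtain S where S: "x = \<phi> S" "S \<subseteq> X" using ex by metis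
    then have "x \<sqinter> \<phi> (X - S) = \<bottom> \<and> x \<squnion> \<phi> (X - S) = \<top>"
      by (simp add: join meet bot_eq top_eq Un_absorb1)
    then show "\<exists>y\<in>carrier K. x \<sqinter> y = \<bottom> \<and> x \<squnion> y = \<top>" using car[of "X - S"] by auto
  qed
  have less: "\<phi> S \<sqsubset> \<phi> S' \<longleftrightarrow> S \<subset> S'" if "S \<subseteq> X" "S' \<subseteq> X" for S S'
    using that iso inj by (auto simp: lless_eq)
  show "coatoms K = (\<lambda>p. \<phi> (X - {p})) ` X"
  proof (intro subset_antisym subsetI)
    fix x assume "x \<in> coatoms K"
    then have x: "x \<in> carrier K" "x \<sqsubset> \<phi> X" and cov: "\<And>c. c \<in> carrier K \<Longrightarrow> \<not> (x \<sqsubset> c \<and> c \<sqsubset> \<phi> X)"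
      by (auto simp: coatoms_def covered_by_def top_eq)
    then obtain S where S: "x = \<phi> S" "S \<subset> X" using ex less by (metis subset_refl)
    then obtain p where p: "p \<in> X" "p \<notin> S" by blast
    have "\<not> (S \<subset> X - {p} \<and> X - {p} \<subset> X)"
      using cov[OF car[of "X - {p}"]] less[of S "X - {p}"] less[of "X - {p}" X] S by auto
    then have "S = X - {p}" using p S by blast
    then show "x \<in> (\<lambda>p. \<phi> (X - {p})) ` X" using p S by auto
  next
    fix x assume "x \<in> (\<lambda>p. \<phi> (X - {p})) ` X"
    then obtain p where p: "p \<in> X" "x = \<phi> (X - {p})" by auto
    have "\<not> (x \<sqsubset> c \<and> c \<sqsubset> \<phi> X)" if c: "c \<in> carrier K" for c
    proof -
      obtain S where "c = \<phi> S" "S \<subseteq> X" using ex[OF c] by auto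
      then show ?thesis using p less[of "X - {p}" S] less[of S X] by auto
    qed
    then show "x \<in> coatoms K"
      using p less[of "X - {p}" X] by (auto simp: coatoms_def covered_by_def top_eq car)
  qed
  define h where "h = (\<lambda>x. card (the_inv_into (Pow X) \<phi> x))"
  have h: "h (\<phi> S) = card S" if "S \<subseteq> X" for S
    using that bij by (simp add: h_def the_inv_into_f_f bij_betw_def)
  have chain: "\<exists>C. is_chain K C \<and> (\<forall>x\<in>C. x \<sqsubseteq> \<phi> S) \<and> h ` C = {..card S}" if "S \<subseteq> X" for S
    using finite_subset[OF that fin] that
  proof (induction S rule: finite_induct)
    case empty
    then show ?case using car[of "{}"] iso[of "{}" "{}"] h[of "{}"]
      by (intro exI[of _ "{\<phi> {}}"]) (auto simp: is_chain_def)
  next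
    case (insert p S)
    then obtain C where C: "is_chain K C" "\<forall>x\<in>C. x \<sqsubseteq> \<phi> S" "h ` C = {..card S}" by auto
    have S: "\<phi> S \<sqsubseteq> \<phi> (insert p S)" "\<phi> S \<in> carrier K" "\<phi> (insert p S) \<in> carrier K"
      using insert iso[of S "insert p S"] car by auto
    then have up: "x \<sqsubseteq> \<phi> (insert p S)" if "x \<in> C" for x
      using C(1,2) that le_trans[of x "\<phi> S" "\<phi> (insert p S)"] by (auto simp: is_chain_def)
    show ?case
      using C(1,3) up S insert(1,2,4) h[of "insert p S"]
      by (intro exI[of _ "insert (\<phi> (insert p S)) C"]) (auto simp: is_chain_def atMost_Suc)
  qed
  obtain C where C: "is_chain K C" "h ` C = {..card X}" using chain[of X] by auto
  have mono: "h x < h y" if xy: "x \<in> carrier K" "y \<in> carrier K" "x \<sqsubseteq> y" "x \<noteq> y" for x y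
  proof -
    obtain S R where SR: "x = \<phi> S" "S \<subseteq> X" "y = \<phi> R" "R \<subseteq> X" using ex[OF xy(1)] ex[OF xy(2)] by auto
    then have "S \<subset> R" using xy iso by auto
    then show ?thesis using SR h psubset_card_mono[OF finite_subset[OF SR(4) fin]] by simp
  qed
  have bound: "h x \<le> card X" if "x \<in> carrier K" for x
    using ex[OF that] h card_mono[OF fin] by auto
  show "finite_length K" "lat_length K = card X" using lat_length_eqI[OF mono bound C] by auto
qed

section \<open>Products\<close>

text \<open>The join and the meet of an order are chosen as some least upper or greatest lower bound, so
  that a homomorphism into a product can be checked only after the componentwise operations have
  been identified with them.\<close>

lemma product_lattice_operations:
  assumes lat: "\<And>i. i \<in> I \<Longrightarrow> lattice (M i)"
  shows "lattice (product_lattice I M)"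
    and "\<lbrakk>f \<in> carrier (product_lattice I M); g \<in> carrier (product_lattice I M)\<rbrakk>
      \<Longrightarrow> f \<squnion>\<^bsub>product_lattice I M\<^esub> g = (\<lambda>i\<in>I. f i \<squnion>\<^bsub>M i\<^esub> g i)"
    and "\<lbrakk>f \<in> carrier (product_lattice I M); g \<in> carrier (product_lattice I M)\<rbrakk>
      \<Longrightarrow> f \<sqinter>\<^bsub>product_lattice I M\<^esub> g = (\<lambda>i\<in>I. f i \<sqinter>\<^bsub>M i\<^esub> g i)"
proof -
  let ?P = "product_lattice I M"
  have cl: "carrier ?P = (\<Pi>\<^sub>E i\<in>I. carrier (M i))" and eq: "(.=\<^bsub>?P\<^esub>) = (=)"
    and le: "\<And>f g. f \<sqsubseteq>\<^bsub>?P\<^esub> g \<longleftrightarrow> (\<forall>i\<in>I. f i \<sqsubseteq>\<^bsub>M i\<^esub> g i)"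
    by (auto simp: product_lattice_def)
  have us: "weak_upper_semilattice (M i)" "weak_lower_semilattice (M i)"
    "partial_order (M i)" "weak_partial_order (M i)" if "i \<in> I" for i
  proof -
    interpret lattice "M i" by (rule lat) fact
    show "weak_upper_semilattice (M i)" "weak_lower_semilattice (M i)"
      "partial_order (M i)" "weak_partial_order (M i)" by unfold_locales
  qed
  interpret P: partial_order ?P
  proof (unfold_locales, unfold eq)
    fix x y z assume "x \<sqsubseteq>\<^bsub>?P\<^esub> y" "y \<sqsubseteq>\<^bsub>?P\<^esub> z" "x \<in> carrier ?P" "y \<in> carrier ?P" "z \<in> carrier ?P"
    then show "x \<sqsubseteq>\<^bsub>?P\<^esub> z"
      unfolding le cl using weak_partial_order.le_trans[OF us(4)] by (meson PiE_mem)
  next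
    fix x y assume "x \<sqsubseteq>\<^bsub>?P\<^esub> y" "y \<sqsubseteq>\<^bsub>?P\<^esub> x" "x \<in> carrier ?P" "y \<in> carrier ?P"
    then show "x = y"
      unfolding le cl using partial_order.le_antisym[OF us(3)] by (meson PiE_mem PiE_ext)
  next
    fix x assume "x \<in> carrier ?P"
    then show "x \<sqsubseteq>\<^bsub>?P\<^esub> x"
      unfolding le cl using weak_partial_order.le_refl[OF us(4)] by (meson PiE_mem)
  qed auto
  have lub: "least ?P (\<lambda>i\<in>I. f i \<squnion>\<^bsub>M i\<^esub> g i) (Upper ?P {f, g})"
    if fg: "f \<in> carrier ?P" "g \<in> carrier ?P" for f g
  proof (rule least_UpperI)
    have fgi: "f i \<in> carrier (M i)" "g i \<in> carrier (M i)" if "i \<in> I" for i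
      using fg that by (auto simp: cl)
    show "(\<lambda>i\<in>I. f i \<squnion>\<^bsub>M i\<^esub> g i) \<in> carrier ?P"
      unfolding cl using weak_upper_semilattice.join_closed[OF us(1)] fgi by auto
    show "x \<sqsubseteq>\<^bsub>?P\<^esub> (\<lambda>i\<in>I. f i \<squnion>\<^bsub>M i\<^esub> g i)" if "x \<in> {f, g}" for x
      using that fgi weak_upper_semilattice.join_left[OF us(1)]
        weak_upper_semilattice.join_right[OF us(1)] by (auto simp: le)
    fix x assume "x \<in> Upper ?P {f, g}"
    then have "x \<in> carrier ?P" "f \<sqsubseteq>\<^bsub>?P\<^esub> x" "g \<sqsubseteq>\<^bsub>?P\<^esub> x" using fg by (auto simp: Upper_def)
    then show "(\<lambda>i\<in>I. f i \<squnion>\<^bsub>M i\<^esub> g i) \<sqsubseteq>\<^bsub>?P\<^esub> x"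
      using fgi weak_upper_semilattice.join_le[OF us(1)] by (auto simp: le cl PiE_iff)
  qed (use fg in auto)
  have glb: "greatest ?P (\<lambda>i\<in>I. f i \<sqinter>\<^bsub>M i\<^esub> g i) (Lower ?P {f, g})"
    if fg: "f \<in> carrier ?P" "g \<in> carrier ?P" for f g
  proof (rule greatest_LowerI)
    have fgi: "f i \<in> carrier (M i)" "g i \<in> carrier (M i)" if "i \<in> I" for i
      using fg that by (auto simp: cl)
    show "(\<lambda>i\<in>I. f i \<sqinter>\<^bsub>M i\<^esub> g i) \<in> carrier ?P"
      unfolding cl using weak_lower_semilattice.meet_closed[OF us(2)] fgi by auto
    show "(\<lambda>i\<in>I. f i \<sqinter>\<^bsub>M i\<^esub> g i) \<sqsubseteq>\<^bsub>?P\<^esub> x" if "x \<in> {f, g}" for x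
      using that fgi weak_lower_semilattice.meet_left[OF us(2)]
        weak_lower_semilattice.meet_right[OF us(2)] by (auto simp: le)
    fix x assume "x \<in> Lower ?P {f, g}"
    then have "x \<in> carrier ?P" "x \<sqsubseteq>\<^bsub>?P\<^esub> f" "x \<sqsubseteq>\<^bsub>?P\<^esub> g" using fg by (auto simp: Lower_def)
    then show "x \<sqsubseteq>\<^bsub>?P\<^esub> (\<lambda>i\<in>I. f i \<sqinter>\<^bsub>M i\<^esub> g i)"
      using fgi weak_lower_semilattice.meet_le[OF us(2)] by (auto simp: le cl PiE_iff)
  qed (use fg in auto)
  show "lattice ?P" by unfold_locales (use lub glb in blast)+
  then interpret P: lattice ?P .
  show "f \<squnion>\<^bsub>?P\<^esub> g = (\<lambda>i\<in>I. f i \<squnion>\<^bsub>M i\<^esub> g i)" if "f \<in> carrier ?P" "g \<in> carrier ?P"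
    unfolding join_def[of ?P] by (rule P.least_unique[OF P.sup_of_two_least lub]) (use that in auto)
  show "f \<sqinter>\<^bsub>?P\<^esub> g = (\<lambda>i\<in>I. f i \<sqinter>\<^bsub>M i\<^esub> g i)" if "f \<in> carrier ?P" "g \<in> carrier ?P"
    unfolding meet_def[of ?P] by (rule P.greatest_unique[OF P.inf_of_two_greatest glb]) (use that in auto)
qed

section \<open>Congruences of a quotient lattice\<close>

text \<open>This is the correspondence theorem: the congruences of \<open>L/\<theta>\<close> are the images of those of \<open>L\<close>
  containing \<open>\<theta>\<close>, in the same order, and the identity of \<open>L/\<theta>\<close> is the image of \<open>\<theta>\<close>. In the proof
  \<open>push\<close> takes a congruence above \<open>\<theta>\<close> to its image, \<open>pull\<close> takes preimages.\<close>

lemma subdirectly_irreducible_quotient_iff: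
  fixes L (structure)
  assumes lat: "lattice L" and \<theta>: "is_congruence L \<theta>"
  shows "subdirectly_irreducible (quotient_lattice L \<theta>) \<longleftrightarrow>
    (\<exists>\<mu>. is_congruence L \<mu> \<and> \<theta> \<subset> \<mu> \<and> (\<forall>\<chi>. is_congruence L \<chi> \<longrightarrow> \<theta> \<subset> \<chi> \<longrightarrow> \<mu> \<subseteq> \<chi>))"
proof -
  interpret lattice L by (rule lat)
  let ?Q = "quotient_lattice L \<theta>"
  let ?c = "\<lambda>x. \<theta> `` {x}"
  note ops = quotient_lattice_operations[OF lat \<theta>]
  interpret Q: lattice ?Q by (rule ops(1))
  have cl: "carrier ?Q = ?c ` carrier L"
    by (auto simp: quotient_lattice_def quotient_def)
  have eqv: "equiv (carrier L) \<chi>" if "is_congruence L \<chi>" for \<chi>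
    using that by (simp add: is_congruence_def)
  have sub: "x \<in> carrier L" "y \<in> carrier L" if "is_congruence L \<chi>" "(x, y) \<in> \<chi>" for \<chi> x y
    using eqv[OF that(1)] that(2) by (auto simp: equiv_def refl_on_def)
  have cls: "?c x = ?c y \<longleftrightarrow> (x, y) \<in> \<theta>" if "x \<in> carrier L" "y \<in> carrier L" for x y
    using eq_equiv_class_iff[OF eqv[OF \<theta>]] that by blast
  define push where "push = (\<lambda>\<chi>. (\<lambda>(x, y). (?c x, ?c y)) ` \<chi>)"
  define pull where "pull = (\<lambda>\<psi>. {(x, y). x \<in> carrier L \<and> y \<in> carrier L \<and> (?c x, ?c y) \<in> \<psi>})"
  have push_iff: "(?c x, ?c y) \<in> push \<chi> \<longleftrightarrow> (x, y) \<in> \<chi>"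
    if \<chi>: "is_congruence L \<chi>" "\<theta> \<subseteq> \<chi>" and xy: "x \<in> carrier L" "y \<in> carrier L" for \<chi> x y
  proof
    assume "(?c x, ?c y) \<in> push \<chi>"
    then obtain x' y' where *: "(x', y') \<in> \<chi>" "?c x = ?c x'" "?c y = ?c y'"
      by (auto simp: push_def)
    have "x' \<in> carrier L" "y' \<in> carrier L" using sub[OF \<chi>(1) *(1)] .
    then have "(x, x') \<in> \<chi>" "(y', y) \<in> \<chi>"
      using cls[of x x'] cls[of y' y] * xy \<chi>(2) by auto
    then show "(x, y) \<in> \<chi>" using * eqv[OF \<chi>(1)] by (meson equivE transD)
  qed (auto simp: push_def)
  have push_cong: "is_congruence ?Q (push \<chi>)" if \<chi>: "is_congruence L \<chi>" "\<theta> \<subseteq> \<chi>" for \<chi>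
  proof -
    note e = eqv[OF \<chi>(1)]
    have s: "push \<chi> \<subseteq> carrier ?Q \<times> carrier ?Q" using sub[OF \<chi>(1)] by (auto simp: push_def cl)
    have rep: "\<exists>x y. A = ?c x \<and> B = ?c y \<and> (x, y) \<in> \<chi> \<and> x \<in> carrier L \<and> y \<in> carrier L"
      if AB: "(A, B) \<in> push \<chi>" for A B
    proof -
      obtain x y where "A = ?c x" "B = ?c y" "(x, y) \<in> \<chi>" using AB by (auto simp: push_def)
      then show ?thesis using sub[OF \<chi>(1)] by blast
    qed
    have r: "refl_on (carrier ?Q) (push \<chi>)"
      using e push_iff[OF \<chi>] by (intro refl_onI) (auto simp: cl equiv_def refl_on_def)
    have y: "sym (push \<chi>)"
    proof (rule symI)
      fix A B assume "(A, B) \<in> push \<chi>"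
      then obtain x y where "A = ?c x" "B = ?c y" "(x, y) \<in> \<chi>" using rep by blast
      then show "(B, A) \<in> push \<chi>" using e by (force simp: push_def equiv_def dest: symD)
    qed
    have t: "trans (push \<chi>)"
    proof (rule transI)
      fix A B C assume "(A, B) \<in> push \<chi>" "(B, C) \<in> push \<chi>"
      then obtain x y y' z where *: "A = ?c x" "B = ?c y" "(x, y) \<in> \<chi>" "x \<in> carrier L"
        "B = ?c y'" "C = ?c z" "(y', z) \<in> \<chi>" "z \<in> carrier L" "y \<in> carrier L" using rep by metis
      then have "(y, z) \<in> \<chi>" using push_iff[OF \<chi>, of y z] by (force simp: push_def)
      then have "(x, z) \<in> \<chi>" using *(3) e by (meson equivE transD)
      then show "(A, C) \<in> push \<chi>" using * by (force simp: push_def)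
    qed
    have "(A \<squnion>\<^bsub>?Q\<^esub> C, B \<squnion>\<^bsub>?Q\<^esub> D) \<in> push \<chi> \<and> (A \<sqinter>\<^bsub>?Q\<^esub> C, B \<sqinter>\<^bsub>?Q\<^esub> D) \<in> push \<chi>"
      if AB: "(A, B) \<in> push \<chi>" and CD: "(C, D) \<in> push \<chi>" for A B C D
    proof -
      obtain a b c d where *: "A = ?c a" "B = ?c b" "(a, b) \<in> \<chi>" "a \<in> carrier L" "b \<in> carrier L"
        "C = ?c c" "D = ?c d" "(c, d) \<in> \<chi>" "c \<in> carrier L" "d \<in> carrier L"
        using rep[OF AB] rep[OF CD] by blast
      have "(a \<squnion> c, b \<squnion> d) \<in> \<chi>" "(a \<sqinter> c, b \<sqinter> d) \<in> \<chi>"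
        using \<chi>(1) *(3,8) by (auto simp: is_congruence_def)
      then show ?thesis using * push_iff[OF \<chi>] by (simp add: ops(2,3))
    qed
    then show ?thesis using s r y t by (auto simp: is_congruence_def equiv_def)
  qed
  have pull_cong: "is_congruence L (pull \<psi>) \<and> \<theta> \<subseteq> pull \<psi> \<and> push (pull \<psi>) = \<psi>"
    if \<psi>: "is_congruence ?Q \<psi>" for \<psi>
  proof -
    have e: "equiv (carrier ?Q) \<psi>" using \<psi> by (simp add: is_congruence_def)
    have r: "\<And>A. A \<in> carrier ?Q \<Longrightarrow> (A, A) \<in> \<psi>" and s: "sym \<psi>" and t: "trans \<psi>"
      and sub\<psi>: "\<And>A B. (A, B) \<in> \<psi> \<Longrightarrow> A \<in> carrier ?Q \<and> B \<in> carrier ?Q"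
      using e by (auto simp: equiv_def refl_on_def)
    have "equiv (carrier L) (pull \<psi>)"
    proof (intro equivI refl_onI symI transI)
      show "(x, z) \<in> pull \<psi>" if "(x, y) \<in> pull \<psi>" "(y, z) \<in> pull \<psi>" for x y z
        using that t by (auto simp: pull_def dest: transD)
      show "(y, x) \<in> pull \<psi>" if "(x, y) \<in> pull \<psi>" for x y
        using that s by (auto simp: pull_def dest: symD)
    qed (use r in \<open>auto simp: pull_def cl\<close>)
    moreover have "(a \<squnion> c, b \<squnion> d) \<in> pull \<psi> \<and> (a \<sqinter> c, b \<sqinter> d) \<in> pull \<psi>"
      if "(a, b) \<in> pull \<psi>" "(c, d) \<in> pull \<psi>" for a b c d
    proof -
      have c: "a \<in> carrier L" "b \<in> carrier L" "c \<in> carrier L" "d \<in> carrier L"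
        and m: "(?c a, ?c b) \<in> \<psi>" "(?c c, ?c d) \<in> \<psi>" using that by (auto simp: pull_def)
      have "(?c a \<squnion>\<^bsub>?Q\<^esub> ?c c, ?c b \<squnion>\<^bsub>?Q\<^esub> ?c d) \<in> \<psi>" "(?c a \<sqinter>\<^bsub>?Q\<^esub> ?c c, ?c b \<sqinter>\<^bsub>?Q\<^esub> ?c d) \<in> \<psi>"
        using \<psi> m unfolding is_congruence_def by blast+
      then show ?thesis using c by (simp add: ops(2,3) pull_def)
    qed
    ultimately have "is_congruence L (pull \<psi>)" by (simp add: is_congruence_def)
    moreover have "\<theta> \<subseteq> pull \<psi>"
    proof
      fix p assume p: "p \<in> \<theta>"
      obtain x y where xy: "p = (x, y)" by (cases p)
      then have c: "x \<in> carrier L" "y \<in> carrier L" using sub[OF \<theta>] p by auto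
      then have "?c x = ?c y" "?c x \<in> carrier ?Q" using cls p xy cl by auto
      then show "p \<in> pull \<psi>" using r c xy by (auto simp: pull_def)
    qed
    moreover have "push (pull \<psi>) = \<psi>"
    proof (intro subset_antisym subsetI)
      fix p assume "p \<in> push (pull \<psi>)"
      then show "p \<in> \<psi>" by (auto simp: push_def pull_def)
    next
      fix p assume p: "p \<in> \<psi>"
      obtain A B where AB: "p = (A, B)" by (cases p)
      then have "A \<in> ?c ` carrier L" "B \<in> ?c ` carrier L" using sub\<psi> p cl by auto
      then obtain x y where "p = (?c x, ?c y)" "x \<in> carrier L" "y \<in> carrier L" using AB by auto
      then show "p \<in> push (pull \<psi>)" using p by (force simp: push_def pull_def)
    qed
    ultimately show ?thesis by blast
  qed
  have push_mono: "push \<chi> \<subseteq> push \<chi>' \<longleftrightarrow> \<chi> \<subseteq> \<chi>'"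
    if "is_congruence L \<chi>" "\<theta> \<subseteq> \<chi>" "is_congruence L \<chi>'" "\<theta> \<subseteq> \<chi>'" for \<chi> \<chi>'
  proof
    assume *: "push \<chi> \<subseteq> push \<chi>'"
    show "\<chi> \<subseteq> \<chi>'"
    proof
      fix p assume p: "p \<in> \<chi>"
      obtain x y where xy: "p = (x, y)" by (cases p)
      then have "(?c x, ?c y) \<in> push \<chi>" using p by (force simp: push_def)
      then show "p \<in> \<chi>'" using * push_iff[OF that(3,4)] sub[OF that(1)] p xy by blast
    qed
  qed (auto simp: push_def)
  have push_\<theta>: "push \<theta> = Id_on (carrier ?Q)"
  proof (intro subset_antisym subsetI)
    fix p assume "p \<in> push \<theta>"
    then obtain x y where p: "(x, y) \<in> \<theta>" "p = (?c x, ?c y)" by (auto simp: push_def)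
    then have "?c x = ?c y" "?c x \<in> carrier ?Q" using cls sub[OF \<theta> p(1)] cl by auto
    then show "p \<in> Id_on (carrier ?Q)" using p by auto
  next
    fix p assume "p \<in> Id_on (carrier ?Q)"
    then obtain x where x: "x \<in> carrier L" "p = (?c x, ?c x)" by (auto simp: cl)
    then have "(x, x) \<in> \<theta>" using cls by blast
    then show "p \<in> push \<theta>" using x by (force simp: push_def)
  qed
  have push_eq_Id: "push \<chi> = Id_on (carrier ?Q) \<longleftrightarrow> \<chi> = \<theta>"
    if "is_congruence L \<chi>" "\<theta> \<subseteq> \<chi>" for \<chi>
    using push_mono[OF that \<theta>] push_\<theta> that(2) by auto
  show ?thesis
  proof
    assume "subdirectly_irreducible ?Q"
    then obtain \<nu> where \<nu>: "is_congruence ?Q \<nu>" "\<nu> \<noteq> Id_on (carrier ?Q)"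
      and min: "\<And>\<psi>. is_congruence ?Q \<psi> \<Longrightarrow> \<psi> \<noteq> Id_on (carrier ?Q) \<Longrightarrow> \<nu> \<subseteq> \<psi>"
      by (auto simp: subdirectly_irreducible_def least_def Con_def)
    note p = pull_cong[OF \<nu>(1)]
    have "pull \<nu> \<noteq> \<theta>" using p push_eq_Id[of "pull \<nu>"] \<nu>(2) by auto
    moreover have "pull \<nu> \<subseteq> \<chi>" if \<chi>: "is_congruence L \<chi>" "\<theta> \<subset> \<chi>" for \<chi>
    proof -
      have "\<nu> \<subseteq> push \<chi>" using \<chi> by (intro min push_cong) (auto simp: push_eq_Id)
      then show ?thesis using push_mono[of "pull \<nu>" \<chi>] p \<chi> by auto
    qed
    ultimately show "\<exists>\<mu>. is_congruence L \<mu> \<and> \<theta> \<subset> \<mu> \<and> (\<forall>\<chi>. is_congruence L \<chi> \<longrightarrow> \<theta> \<subset> \<chi> \<longrightarrow> \<mu> \<subseteq> \<chi>)"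
      using p by (intro exI[of _ "pull \<nu>"]) auto
  next
    assume "\<exists>\<mu>. is_congruence L \<mu> \<and> \<theta> \<subset> \<mu> \<and> (\<forall>\<chi>. is_congruence L \<chi> \<longrightarrow> \<theta> \<subset> \<chi> \<longrightarrow> \<mu> \<subseteq> \<chi>)"
    then obtain \<mu> where \<mu>: "is_congruence L \<mu>" "\<theta> \<subset> \<mu>"
      and min: "\<And>\<chi>. is_congruence L \<chi> \<Longrightarrow> \<theta> \<subset> \<chi> \<Longrightarrow> \<mu> \<subseteq> \<chi>" by blast
    have "push \<mu> \<subseteq> \<psi>" if \<psi>: "is_congruence ?Q \<psi>" "\<psi> \<noteq> Id_on (carrier ?Q)" for \<psi>
    proof -
      note p = pull_cong[OF \<psi>(1)]
      have "pull \<psi> \<noteq> \<theta>" using p push_eq_Id[of "pull \<psi>"] \<psi>(2) by auto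
      then have "\<mu> \<subseteq> pull \<psi>" using p by (intro min) auto
      then show ?thesis using push_mono[of \<mu> "pull \<psi>"] p \<mu> by auto
    qed
    moreover have "is_congruence ?Q (push \<mu>)" using push_cong \<mu> by auto
    moreover have "push \<mu> \<noteq> Id_on (carrier ?Q)" using push_eq_Id[of \<mu>] \<mu> by auto
    ultimately have "least (Con ?Q) (push \<mu>) (carrier (Con ?Q) - {Id_on (carrier ?Q)})"
      by (simp add: least_def Con_def)
    then show "subdirectly_irreducible ?Q" using ops(1) by (auto simp: subdirectly_irreducible_def)
  qed
qed

section \<open>Coverings in a modular lattice of finite length\<close>

locale finite_length_modular_lattice = modular_lattice +
  assumes nonempty: "carrier L \<noteq> {}" and finite_length: "finite_length L"
begin

lemma meet_eq: "\<lbrakk>x \<sqsubseteq> y; x \<in> carrier L; y \<in> carrier L\<rbrakk> \<Longrightarrow> x \<sqinter> y = x \<and> y \<sqinter> x = x"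
  using le_iff_join[of x y] meet_comm[of L x y] by simp

lemma join_eq: "\<lbrakk>x \<sqsubseteq> y; x \<in> carrier L; y \<in> carrier L\<rbrakk> \<Longrightarrow> x \<squnion> y = y \<and> y \<squnion> x = y"
  using le_iff_meet[of x y] join_comm[of L x y] by simp

lemma covered_byD:
  assumes "covered_by L a b"
  shows "a \<in> carrier L" "b \<in> carrier L" "a \<sqsubseteq> b" "a \<noteq> b"
    "\<And>c. \<lbrakk>c \<in> carrier L; a \<sqsubseteq> c; c \<sqsubseteq> b\<rbrakk> \<Longrightarrow> c = a \<or> c = b"
  using assms by (auto simp: covered_by_def lless_eq)

lemma covered_byI:
  assumes "a \<in> carrier L" "b \<in> carrier L" "a \<sqsubseteq> b" "a \<noteq> b"
    "\<And>c. \<lbrakk>c \<in> carrier L; a \<sqsubseteq> c; c \<sqsubseteq> b\<rbrakk> \<Longrightarrow> c = a \<or> c = b"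
  shows "covered_by L a b"
  using assms by (auto simp: covered_by_def lless_eq)

text \<open>Finite length is used only through this strictly increasing bounded function. It supplies
  extremal elements and induction.\<close>

definition rank :: "'a \<Rightarrow> nat" where
  "rank x = Max (card ` {C. is_chain L C \<and> (\<forall>y\<in>C. y \<sqsubseteq> x)})"

lemma finite_chain_cards: "finite (card ` {C. is_chain L C \<and> (\<forall>y\<in>C. y \<sqsubseteq> x)})"
proof -
  obtain n where "\<And>C. is_chain L C \<Longrightarrow> card C \<le> n"
    using finite_length by (auto simp: finite_length_def)
  then have "card ` {C. is_chain L C \<and> (\<forall>y\<in>C. y \<sqsubseteq> x)} \<subseteq> {..n}" by auto
  then show ?thesis by (rule finite_subset) simp
qed

lemma rank_attained: "\<exists>C. is_chain L C \<and> (\<forall>y\<in>C. y \<sqsubseteq> x) \<and> card C = rank x"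
proof -
  have "{} \<in> {C. is_chain L C \<and> (\<forall>y\<in>C. y \<sqsubseteq> x)}" by (simp add: is_chain_def)
  then have "card ` {C. is_chain L C \<and> (\<forall>y\<in>C. y \<sqsubseteq> x)} \<noteq> {}" by blast
  from Max_in[OF finite_chain_cards this] show ?thesis unfolding rank_def by force
qed

lemma rank_strict_mono:
  assumes "x \<in> carrier L" "y \<in> carrier L" "x \<sqsubseteq> y" "x \<noteq> y"
  shows "rank x < rank y"
proof -
  obtain C where C: "is_chain L C" "\<And>z. z \<in> C \<Longrightarrow> z \<sqsubseteq> x" "card C = rank x"
    using rank_attained by blast
  have car: "z \<in> carrier L" if "z \<in> C" for z using C(1) that by (auto simp: is_chain_def)
  have le: "z \<sqsubseteq> y" if "z \<in> C" for z using le_trans[OF C(2) assms(3)] car that assms by blast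
  have "y \<notin> C" using C(2)[of y] assms le_antisym by blast
  moreover have "is_chain L (insert y C)" using C(1) le assms by (auto simp: is_chain_def)
  moreover have "finite C" using C(1) finite_length by (auto simp: finite_length_def)
  moreover have "card (insert y C) \<le> rank y"
    unfolding rank_def using calculation(2) le assms
    by (intro Max_ge finite_chain_cards imageI) auto
  ultimately show ?thesis using C(3) by simp
qed

lemma rank_bounded: "\<exists>n. \<forall>x. rank x \<le> n"
  using rank_attained finite_length unfolding finite_length_def by metis

lemma lower_bound_exists: "\<exists>x. least L x (carrier L)"
proof -
  obtain x where x: "x \<in> carrier L" and min: "\<And>y. y \<in> carrier L \<Longrightarrow> rank x \<le> rank y"
    using nonempty
      ex_has_least_nat[of "\<lambda>x. x \<in> carrier L" _ rank] by blast
  have "x \<sqsubseteq> y" if y: "y \<in> carrier L" for y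
  proof -
    have "x \<sqinter> y = x"
      using rank_strict_mono[of "x \<sqinter> y" x] min[of "x \<sqinter> y"] meet_left[of x y] x y by fastforce
    then show ?thesis using meet_right[OF x y] by simp
  qed
  then show ?thesis using x by (auto simp: least_def)
qed

lemma upper_bound_exists: "\<exists>x. greatest L x (carrier L)"
proof -
  obtain n where n: "\<And>x. rank x \<le> n" using rank_bounded by blast
  obtain x where x: "x \<in> carrier L" and max: "\<And>y. y \<in> carrier L \<Longrightarrow> rank y \<le> rank x"
    using nonempty ex_has_greatest_nat[of "\<lambda>x. x \<in> carrier L" _ rank "Suc n"] n
    by (metis all_not_in_conv le_imp_less_Suc)
  have "y \<sqsubseteq> x" if y: "y \<in> carrier L" for y
  proof -
    have "x \<squnion> y = x"
      using rank_strict_mono[of x "x \<squnion> y"] max[of "x \<squnion> y"] join_left[of x y] x y by fastforce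
    then show ?thesis using join_right[OF x y] by simp
  qed
  then show ?thesis using x by (auto simp: greatest_def)
qed

sublocale bounded_lattice L
  by unfold_locales (rule lower_bound_exists upper_bound_exists)+

lemma cover_exists:
  assumes "x \<in> carrier L" "y \<in> carrier L" "x \<sqsubseteq> y" "x \<noteq> y"
  shows "\<exists>u. x \<sqsubseteq> u \<and> covered_by L u y"
proof -
  let ?Q = "\<lambda>u. u \<in> carrier L \<and> x \<sqsubseteq> u \<and> u \<sqsubseteq> y \<and> u \<noteq> y"
  obtain n where n: "\<And>x. rank x \<le> n" using rank_bounded by blast
  have "?Q x" using assms by simp
  then obtain u where u: "?Q u" and max: "\<And>v. ?Q v \<Longrightarrow> rank v \<le> rank u"
    using ex_has_greatest_nat[of ?Q x rank "Suc n"] n by (auto simp: less_Suc_eq_le)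
  have "c = u \<or> c = y" if c: "c \<in> carrier L" "u \<sqsubseteq> c" "c \<sqsubseteq> y" for c
  proof (rule ccontr)
    assume "\<not> (c = u \<or> c = y)"
    moreover have "x \<sqsubseteq> c" using le_trans[of x u c] u c assms(1) by simp
    ultimately show False using max[of c] rank_strict_mono[of u c] u c by force
  qed
  then have "covered_by L u y" using u assms by (intro covered_byI) auto
  then show ?thesis using u by blast
qed

text \<open>A property of \<open>x\<close> that passes up every covering of \<open>[x, y]\<close> holds at \<open>y\<close>. This replaces all
  inductions along a maximal chain of an interval.\<close>

lemma interval_induct [consumes 3, case_names base step]:
  assumes "x \<sqsubseteq> y" "x \<in> carrier L" "y \<in> carrier L"
    and base: "P x"
    and step: "\<And>u v. \<lbrakk>x \<sqsubseteq> u; v \<sqsubseteq> y; covered_by L u v; P u\<rbrakk> \<Longrightarrow> P v"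
  shows "P y"
proof -
  have "t \<in> carrier L \<longrightarrow> x \<sqsubseteq> t \<longrightarrow> t \<sqsubseteq> y \<longrightarrow> P t" for t
  proof (induction t rule: measure_induct_rule[where f = rank])
    case (less t)
    show ?case
    proof (intro impI)
      assume t: "t \<in> carrier L" "x \<sqsubseteq> t" "t \<sqsubseteq> y"
      show "P t"
      proof (cases "x = t")
        case False
        then obtain u where u: "x \<sqsubseteq> u" "covered_by L u t" using cover_exists[OF assms(2) t(1,2)] by blast
        note c = covered_byD[OF u(2)]
        have "u \<sqsubseteq> y" using le_trans[OF c(3) t(3)] c(1) t(1) assms(3) by simp
        then have "P u" using less[OF rank_strict_mono[OF c(1-4)]] c(1) u(1) by simp
        then show ?thesis using step[OF u(1) t(3) u(2)] by simp
      qed (use base in simp)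
    qed
  qed
  then show ?thesis using assms by simp
qed

text \<open>For \<open>a = bc\<close>, the maps \<open>t \<mapsto> t + c\<close> and \<open>t \<mapsto> bt\<close> are inverse to each other between \<open>[a, b]\<close>
  and \<open>[c, b + c]\<close> by modularity, so that an interval transposed upwards from a covering is a covering.\<close>

lemma covered_by_join:
  assumes ab: "covered_by L a b" and c: "c \<in> carrier L" "a = b \<sqinter> c"
  shows "covered_by L c (b \<squnion> c)"
proof (rule covered_byI)
  note ab = covered_byD[OF ab]
  show "c \<in> carrier L" "b \<squnion> c \<in> carrier L" "c \<sqsubseteq> b \<squnion> c" using ab c join_right by auto
  have ac: "a \<sqsubseteq> c" using c ab meet_right by auto
  show "c \<noteq> b \<squnion> c"
  proof
    assume "c = b \<squnion> c"
    then have "b \<sqsubseteq> c" using join_left[of b c] ab c by simp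
    then show False using meet_eq[of b c] ab c by simp
  qed
  fix t assume t: "t \<in> carrier L" "c \<sqsubseteq> t" "t \<sqsubseteq> b \<squnion> c"
  have at: "a \<sqsubseteq> t" using le_trans[OF ac t(2)] ab c t by blast
  have "a \<sqsubseteq> b \<sqinter> t" using meet_le[OF ab(3) at] ab t by simp
  then consider "b \<sqinter> t = a" | "b \<sqinter> t = b"
    using ab(5)[of "b \<sqinter> t"] meet_left[of b t] ab(1,2) t(1) by auto
  then show "t = c \<or> t = b \<squnion> c"
  proof cases
    case 1
    have "c \<squnion> (b \<sqinter> t) = (c \<squnion> b) \<sqinter> t" using modular_law c ab t by simp
    then have "t = c \<squnion> a" using 1 meet_eq[OF t(3)] join_comm[of L c b] ab c t by simp
    then show ?thesis using join_eq[OF ac] ab c by simp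
  next
    case 2
    then have "b \<sqsubseteq> t" using meet_right[of b t] ab t by simp
    then have "b \<squnion> c \<sqsubseteq> t" using join_le t ab c by simp
    then show ?thesis using le_antisym t ab c by simp
  qed
qed

lemma covered_by_meet:
  assumes cd: "covered_by L c d" and b: "b \<in> carrier L" "d = b \<squnion> c"
  shows "covered_by L (b \<sqinter> c) b"
proof (rule covered_byI)
  note cd = covered_byD[OF cd]
  show "b \<sqinter> c \<in> carrier L" "b \<in> carrier L" "b \<sqinter> c \<sqsubseteq> b" using cd b meet_left by auto
  have bd: "b \<sqsubseteq> d" using b cd join_left by auto
  show "b \<sqinter> c \<noteq> b"
  proof
    assume "b \<sqinter> c = b"
    then have "b \<sqsubseteq> c" using meet_right[of b c] b cd by simp
    then show False using join_eq[of b c] cd b by simp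
  qed
  fix t assume t: "t \<in> carrier L" "b \<sqinter> c \<sqsubseteq> t" "t \<sqsubseteq> b"
  have td: "t \<sqsubseteq> d" using le_trans[OF t(3) bd] b cd t by blast
  have "t \<squnion> c \<sqsubseteq> d" using join_le[OF td cd(3)] cd t by simp
  then consider "t \<squnion> c = c" | "t \<squnion> c = d" using cd(5)[of "t \<squnion> c"] join_right[of t c] cd(1,2) t(1) by auto
  then show "t = b \<sqinter> c \<or> t = b"
  proof cases
    case 1
    then have "t \<sqsubseteq> c" using join_left[of t c] cd t by simp
    then have "t \<sqsubseteq> b \<sqinter> c" using meet_le t cd b by simp
    then show ?thesis using le_antisym t cd b by simp
  next
    case 2
    have "t \<squnion> (c \<sqinter> b) = (t \<squnion> c) \<sqinter> b" using modular_law cd b t by simp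
    then show ?thesis
      using 2 meet_eq[OF bd] join_eq[OF t(2)] meet_comm[of L c b] cd b t by simp
  qed
qed

section \<open>Projectivity classes\<close>

abbreviation proj_class :: "'a \<times> 'a \<Rightarrow> ('a \<times> 'a) set" where
  "proj_class p \<equiv> (transposition_graph L)\<^sup>* `` {p}"

lemma proj_class_eq_iff: "proj_class p = proj_class q \<longleftrightarrow> (p, q) \<in> (transposition_graph L)\<^sup>*"
proof -
  have "transposed L p q \<Longrightarrow> transposed L q p" for p q :: "'a \<times> 'a"
    by (cases p; cases q) (auto simp: meet_comm join_comm)
  then have "sym ((transposition_graph L)\<^sup>*)"
    by (intro sym_rtrancl) (auto simp: sym_def transposition_graph_def)
  then have "equiv UNIV ((transposition_graph L)\<^sup>*)"
    by (simp add: equiv_def refl_rtrancl trans_rtrancl)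
  then show ?thesis by (simp add: eq_equiv_class_iff)
qed

lemma proj_classes_iff:
  "P \<in> proj_classes L \<longleftrightarrow> (\<exists>a b. covered_by L a b \<and> P = proj_class (a, b))"
  by (auto simp: proj_classes_def quotient_def Cov_def)

lemma mem_proj_class_iff:
  assumes "P \<in> proj_classes L"
  shows "(a, b) \<in> P \<longleftrightarrow> proj_class (a, b) = P"
proof -
  obtain q where q: "P = proj_class q" using assms by (auto simp: proj_classes_iff)
  show ?thesis using proj_class_eq_iff[of q "(a, b)"] by (auto simp: q)
qed

lemma proj_class_transposed:
  assumes "covered_by L a b" "c \<in> carrier L" "a = b \<sqinter> c"
  shows "proj_class (a, b) = proj_class (c, b \<squnion> c)"
  unfolding proj_class_eq_iff using covered_by_join[OF assms] assms
  by (intro r_into_rtrancl) (simp add: transposition_graph_def Cov_def)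

section \<open>The multiset of composition factors\<close>

text \<open>A maximal chain from \<open>0\<close> to \<open>x\<close> is kept only as the multiset of the classes that it meets. The
  chain grows at its upper end, so that all chains share the fixed start \<open>0\<close>.\<close>

inductive composition_factors :: "'a \<Rightarrow> ('a \<times> 'a) set multiset \<Rightarrow> bool" where
  bottom: "composition_factors \<bottom> {#}"
| step: "composition_factors x M \<Longrightarrow> covered_by L x y
    \<Longrightarrow> composition_factors y (add_mset (proj_class (x, y)) M)"

lemma composition_factors_exist: "x \<in> carrier L \<Longrightarrow> \<exists>M. composition_factors x M"
  by (rule interval_induct[of \<bottom> x]) (auto intro: composition_factors.intros)

lemma not_covered_by_bottom: "\<not> covered_by L x \<bottom>"
  using covered_byD[of x \<bottom>] bottom_lower le_antisym by blast

text \<open>Jordan-Hoelder, by induction on the length. If the last coverings \<open>(u, x)\<close> and \<open>(v, x)\<close>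
  differ, then \<open>uv\<close> is covered by \<open>u\<close> and by \<open>v\<close>. Any chain up to \<open>uv\<close> can be continued through
  either of them; by induction the continuations agree with the given chains up to \<open>u\<close> and up to \<open>v\<close>,
  and the last two steps of both continuations to \<open>x\<close> have the same two classes, in opposite order.\<close>

lemma composition_factors_unique:
  "composition_factors x M \<Longrightarrow> composition_factors x N \<Longrightarrow> M = N"
proof (induction "size M" arbitrary: x M N)
  case 0
  then have "x = \<bottom>" by (auto elim: composition_factors.cases)
  then show ?case using 0 not_covered_by_bottom by (auto elim: composition_factors.cases)
next
  case (Suc n)
  from Suc.prems(1) Suc.hyps(2) obtain u M' where u: "composition_factors u M'" "covered_by L u x"
    "M = add_mset (proj_class (u, x)) M'" by (auto elim: composition_factors.cases)
  from Suc.prems(2) u(2) not_covered_by_bottom obtain v N' where v: "composition_factors v N'"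
    "covered_by L v x" "N = add_mset (proj_class (v, x)) N'" by (auto elim: composition_factors.cases)
  have n: "n = size M'" using Suc.hyps(2) u by simp
  note cu = covered_byD[OF u(2)] and cv = covered_byD[OF v(2)]
  show ?case
  proof (cases "u = v")
    case True
    then show ?thesis using Suc.hyps(1)[OF n] u v by simp
  next
    case False
    let ?w = "u \<sqinter> v"
    have uv: "u \<squnion> v = x"
    proof -
      have "u \<squnion> v \<sqsubseteq> x" using join_le cu cv by simp
      then have "u \<squnion> v = u \<or> u \<squnion> v = x" using cu(5)[of "u \<squnion> v"] join_left[of u v] cu cv by simp
      moreover have "u \<squnion> v \<noteq> u"
      proof
        assume "u \<squnion> v = u"
        then have "v \<sqsubseteq> u" using join_right[of u v] cu cv by simp
        then show False using cv(5)[of u] cu False by blast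
      qed
      ultimately show ?thesis by simp
    qed
    have wu: "covered_by L ?w u" using covered_by_meet[OF v(2) cu(1)] uv by simp
    have wv: "covered_by L ?w v"
      using covered_by_meet[OF u(2) cv(1)] uv meet_comm[of L u v] join_comm[of L u v] by simp
    obtain K where K: "composition_factors ?w K" using composition_factors_exist cu cv by force
    \<comment> \<open>This also shows that the chain through \<open>v\<close> has length \<open>n\<close>, as the induction requires.\<close>
    have M': "M' = add_mset (proj_class (?w, u)) K"
      using Suc.hyps(1)[OF n u(1)] composition_factors.step[OF K wu] by simp
    have "add_mset (proj_class (?w, v)) K = N'"
      using Suc.hyps(1)[OF _ composition_factors.step[OF K wv] v(1)] n M' by simp
    moreover have "proj_class (?w, u) = proj_class (v, x)"
      using proj_class_transposed[OF wu cv(1)] uv by simp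
    moreover have "proj_class (?w, v) = proj_class (u, x)"
      using proj_class_transposed[OF wv cu(1)] uv meet_comm[of L u v] join_comm[of L u v] by simp
    ultimately show ?thesis using M' u(3) v(3) by auto
  qed
qed

definition factors :: "'a \<Rightarrow> ('a \<times> 'a) set multiset" where
  "factors x = (THE M. composition_factors x M)"

lemma factors_eq: "composition_factors x M \<Longrightarrow> factors x = M"
  unfolding factors_def using composition_factors_unique by blast

lemma factors_bottom: "factors \<bottom> = {#}"
  by (rule factors_eq) (rule composition_factors.bottom)

lemma factors_covered_by: "covered_by L x y \<Longrightarrow> factors y = add_mset (proj_class (x, y)) (factors x)"
proof -
  assume c: "covered_by L x y"
  obtain M where M: "composition_factors x M"
    using composition_factors_exist[OF covered_byD(1)[OF c]] by blast
  show ?thesis using factors_eq[OF M] factors_eq[OF composition_factors.step[OF M c]] by simp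
qed

text \<open>For \<open>t\<close> running through a maximal chain of \<open>[xy, y]\<close>, each covering is transposed to the covering
  of the elements \<open>x + t\<close>, which run from \<open>x\<close> to \<open>x + y\<close>. Thus \<open>factors\<close> gains the same classes on
  both ways.\<close>

lemma factors_modular:
  assumes x: "x \<in> carrier L" and y: "y \<in> carrier L"
  shows "factors (x \<squnion> y) + factors (x \<sqinter> y) = factors x + factors y"
proof (rule interval_induct[OF meet_right[OF x y] meet_closed[OF x y] y,
      where P = "\<lambda>t. factors (x \<squnion> t) + factors (x \<sqinter> y) = factors x + factors t"], goal_cases base step)
  case base
  then show ?case using join_eq[OF meet_left[OF x y]] x y by simp
next
  case (step u v)
  note c = covered_byD(1,2)[OF step(3)] and uv = covered_byD(3)[OF step(3)]
  \<comment> \<open>The transposition condition is \<open>v (x + u) = u\<close>; by modularity the left side is \<open>u + xv\<close>, and \<open>xv \<sqsubseteq> xy \<sqsubseteq> u\<close>.\<close>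
  have vx: "x \<sqinter> v \<in> carrier L" "x \<sqinter> y \<in> carrier L" using x y c by auto
  have "x \<sqinter> v \<sqsubseteq> y" by (rule le_trans[OF meet_right[OF x c(2)] step(2) vx(1) c(2) y])
  then have "x \<sqinter> v \<sqsubseteq> x \<sqinter> y" by (rule meet_le[OF meet_left[OF x c(2)] _ x y vx(1)])
  then have "x \<sqinter> v \<sqsubseteq> u" by (rule le_trans[OF _ step(1) vx c(1)])
  then have "u \<squnion> (x \<sqinter> v) = u" using join_eq[of "x \<sqinter> v" u] vx c by simp
  moreover have "u \<squnion> (x \<sqinter> v) = (u \<squnion> x) \<sqinter> v" using modular_law[of u x v] x c uv by simp
  ultimately have u_eq: "u = v \<sqinter> (x \<squnion> u)"
    using join_comm[of L u x] meet_comm[of L v "x \<squnion> u"] by simp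
  have v_eq: "v \<squnion> (x \<squnion> u) = x \<squnion> v"
    using weak_join_assoc[OF x c] join_comm[of L v "x \<squnion> u"] join_eq[OF uv c] by (simp add: eq_is_equal)
  have "factors (x \<squnion> v) = add_mset (proj_class (u, v)) (factors (x \<squnion> u))"
    using factors_covered_by[OF covered_by_join[OF step(3) join_closed[OF x c(1)] u_eq]]
      proj_class_transposed[OF step(3) join_closed[OF x c(1)] u_eq] v_eq by simp
  then show ?case using step(4) factors_covered_by[OF step(3)] by simp
qed

section \<open>Class valuations and their kernels\<close>

lemma factors_mono:
  assumes "x \<sqsubseteq> y" "x \<in> carrier L" "y \<in> carrier L"
  shows "factors x \<subseteq># factors y"
  using assms
  by (rule interval_induct) (auto simp: factors_covered_by intro: subset_mset.order_trans)

definition val :: "('a \<times> 'a) set set \<Rightarrow> 'a \<Rightarrow> nat" where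
  "val T x = size (filter_mset (\<lambda>P. P \<in> T) (factors x))"

lemma val_bottom: "val T \<bottom> = 0"
  by (simp add: val_def factors_bottom)

lemma val_covered_by:
  "covered_by L x y \<Longrightarrow> val T y = (if proj_class (x, y) \<in> T then Suc (val T x) else val T x)"
  by (simp add: val_def factors_covered_by)

lemma val_mono: "\<lbrakk>x \<sqsubseteq> y; x \<in> carrier L; y \<in> carrier L\<rbrakk> \<Longrightarrow> val T x \<le> val T y"
  unfolding val_def by (intro size_mset_mono multiset_filter_mono factors_mono)

lemma val_modular:
  assumes "x \<in> carrier L" "y \<in> carrier L"
  shows "val T (x \<squnion> y) + val T (x \<sqinter> y) = val T x + val T y"
  using factors_modular[OF assms] unfolding val_def
  by (metis filter_union_mset size_union)

lemma val_strict_mono: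
  assumes "x \<sqsubseteq> y" "x \<in> carrier L" "y \<in> carrier L" "x \<noteq> y"
  shows "val UNIV x < val UNIV y"
proof -
  obtain u where u: "x \<sqsubseteq> u" "covered_by L u y" using cover_exists assms by blast
  have "val UNIV x \<le> val UNIV u" using val_mono u(1) covered_byD(1)[OF u(2)] assms(2) by simp
  then show ?thesis using val_covered_by[OF u(2), of UNIV] by simp
qed

lemma join_mono: "\<lbrakk>x \<sqsubseteq> y; x \<in> carrier L; y \<in> carrier L; c \<in> carrier L\<rbrakk> \<Longrightarrow> x \<squnion> c \<sqsubseteq> y \<squnion> c"
  by (rule join_le[OF le_trans[OF _ join_left] join_right]) simp_all

lemma meet_mono: "\<lbrakk>x \<sqsubseteq> y; x \<in> carrier L; y \<in> carrier L; c \<in> carrier L\<rbrakk> \<Longrightarrow> x \<sqinter> c \<sqsubseteq> y \<sqinter> c"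
  by (rule meet_le[OF le_trans[OF meet_left] meet_right]) simp_all

lemma meet_le_join: "\<lbrakk>x \<in> carrier L; y \<in> carrier L\<rbrakk> \<Longrightarrow> x \<sqinter> y \<sqsubseteq> x \<squnion> y"
  by (rule le_trans[OF meet_left join_left]) simp_all

text \<open>The increments of an isotone valuation on \<open>[x + c, y + c]\<close> and on \<open>[xc, yc]\<close> are nonnegative and
  add up to its increment on \<open>[x, y]\<close>. So if the last one is zero, both vanish.\<close>

lemma val_eq_translate:
  assumes xy: "x \<sqsubseteq> y" "x \<in> carrier L" "y \<in> carrier L" and c: "c \<in> carrier L"
    and eq: "val T x = val T y"
  shows "val T (x \<squnion> c) = val T (y \<squnion> c)" "val T (x \<sqinter> c) = val T (y \<sqinter> c)"
proof -
  have "val T (x \<squnion> c) \<le> val T (y \<squnion> c)" "val T (x \<sqinter> c) \<le> val T (y \<sqinter> c)"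
    using val_mono[OF join_mono[OF xy c]] val_mono[OF meet_mono[OF xy c]] xy c by auto
  then show "val T (x \<squnion> c) = val T (y \<squnion> c)" "val T (x \<sqinter> c) = val T (y \<sqinter> c)"
    using val_modular[OF xy(2) c, of T] val_modular[OF xy(3) c, of T] eq by auto
qed

definition ker :: "('a \<times> 'a) set set \<Rightarrow> ('a \<times> 'a) set" where
  "ker T = {(x, y). x \<in> carrier L \<and> y \<in> carrier L \<and> val T (x \<sqinter> y) = val T (x \<squnion> y)}"

lemma kerD:
  assumes "(x, y) \<in> ker T"
  shows "x \<in> carrier L" "y \<in> carrier L" "val T (x \<sqinter> y) = val T (x \<squnion> y)"
    "val T x = val T (x \<sqinter> y)" "val T y = val T (x \<sqinter> y)"
proof -
  show c: "x \<in> carrier L" "y \<in> carrier L" "val T (x \<sqinter> y) = val T (x \<squnion> y)"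
    using assms by (auto simp: ker_def)
  have "val T (x \<sqinter> y) \<le> val T x" "val T x \<le> val T (x \<squnion> y)"
    "val T (x \<sqinter> y) \<le> val T y" "val T y \<le> val T (x \<squnion> y)"
    using c(1,2) by (auto intro!: val_mono meet_left meet_right join_left join_right)
  then show "val T x = val T (x \<sqinter> y)" "val T y = val T (x \<sqinter> y)" using c(3) by auto
qed

lemma ker_le_iff:
  "\<lbrakk>x \<sqsubseteq> y; x \<in> carrier L; y \<in> carrier L\<rbrakk> \<Longrightarrow> (x, y) \<in> ker T \<longleftrightarrow> val T x = val T y"
  by (simp add: ker_def meet_eq join_eq)

text \<open>An interval on which the valuation is constant lies in a single class of \<open>ker T\<close>. This reduces
  the congruence laws to constancy on suitable intervals.\<close>

lemma ker_squeeze: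
  assumes "a \<sqsubseteq> x" "a \<sqsubseteq> y" "x \<sqsubseteq> b" "y \<sqsubseteq> b" and eq: "val T a = val T b"
    and c: "a \<in> carrier L" "b \<in> carrier L" "x \<in> carrier L" "y \<in> carrier L"
  shows "(x, y) \<in> ker T"
proof -
  have "a \<sqsubseteq> x \<sqinter> y" "x \<squnion> y \<sqsubseteq> b" using assms by (auto intro: meet_le join_le)
  then have "val T a \<le> val T (x \<sqinter> y)" "val T (x \<sqinter> y) \<le> val T (x \<squnion> y)" "val T (x \<squnion> y) \<le> val T b"
    using c meet_le_join[of x y] by (auto intro!: val_mono)
  then show ?thesis using eq c by (simp add: ker_def)
qed

lemma ker_sym: "(x, y) \<in> ker T \<Longrightarrow> (y, x) \<in> ker T"
  by (simp add: ker_def meet_comm[of L x] join_comm[of L x])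

lemma ker_trans:
  assumes xy: "(x, y) \<in> ker T" and yz: "(y, z) \<in> ker T"
  shows "(x, z) \<in> ker T"
proof -
  note c = kerD(1,2)[OF xy] kerD(2)[OF yz]
  have m: "x \<sqinter> y \<in> carrier L" and j: "x \<squnion> y \<in> carrier L" using c by auto
  have "val T (x \<sqinter> y \<sqinter> z) = val T (y \<sqinter> z)"
    by (rule val_eq_translate(2)[OF meet_right[OF c(1,2)] m c(2,3)]) (use kerD[OF xy] in simp)
  also have "\<dots> = val T (y \<squnion> z)" by (rule kerD(3)[OF yz])
  also have "\<dots> = val T (x \<squnion> y \<squnion> z)"
    by (rule val_eq_translate(1)[OF join_right[OF c(1,2)] c(2) j c(3)]) (use kerD[OF xy] in simp)
  finally have eq: "val T (x \<sqinter> y \<sqinter> z) = val T (x \<squnion> y \<squnion> z)" .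
  show ?thesis
  proof (rule ker_squeeze[OF _ _ _ _ eq])
    show "x \<sqinter> y \<sqinter> z \<sqsubseteq> x" by (rule le_trans[OF meet_left meet_left]) (use c m in auto)
    show "x \<sqsubseteq> x \<squnion> y \<squnion> z" by (rule le_trans[OF join_left join_left]) (use c j in auto)
    show "x \<sqinter> y \<sqinter> z \<sqsubseteq> z" "z \<sqsubseteq> x \<squnion> y \<squnion> z" using meet_right[OF m c(3)] join_right[OF j c(3)] .
  qed (use c in auto)
qed

text \<open>Compatibility with one fixed operand suffices, as the two-sided laws follow by transitivity.\<close>

lemma ker_translate:
  assumes xy: "(x, y) \<in> ker T" and c: "c \<in> carrier L"
  shows "(x \<squnion> c, y \<squnion> c) \<in> ker T" "(x \<sqinter> c, y \<sqinter> c) \<in> ker T"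
proof -
  note k = kerD(1,2)[OF xy]
  have mj: "x \<sqinter> y \<in> carrier L" "x \<squnion> y \<in> carrier L" using k by auto
  note le = meet_left[OF k] meet_right[OF k] join_left[OF k] join_right[OF k]
  note eq = val_eq_translate[OF meet_le_join[OF k] mj c kerD(3)[OF xy]]
  show "(x \<squnion> c, y \<squnion> c) \<in> ker T"
    by (rule ker_squeeze[OF _ _ _ _ eq(1)]) (use k mj c le in \<open>auto intro!: join_mono\<close>)
  show "(x \<sqinter> c, y \<sqinter> c) \<in> ker T"
    by (rule ker_squeeze[OF _ _ _ _ eq(2)]) (use k mj c le in \<open>auto intro!: meet_mono\<close>)
qed

lemma ker_congruence: "is_congruence L (ker T)"
proof -
  have "refl_on (carrier L) (ker T)"
    by (rule refl_onI) (simp add: ker_le_iff)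
  moreover have "ker T \<subseteq> carrier L \<times> carrier L" by (auto simp: ker_def)
  moreover have "sym (ker T)" "trans (ker T)" by (blast intro: symI transI ker_sym ker_trans)+
  moreover have "(a \<squnion> c, b \<squnion> d) \<in> ker T \<and> (a \<sqinter> c, b \<sqinter> d) \<in> ker T"
    if ab: "(a, b) \<in> ker T" and cd: "(c, d) \<in> ker T" for a b c d
  proof -
    note c = kerD(1,2)[OF ab] kerD(1,2)[OF cd]
    show ?thesis
      using ker_trans[OF ker_translate(1)[OF ab c(3)] ker_translate(1)[OF cd c(2), unfolded join_comm[of L c b] join_comm[of L d b]]]
        ker_trans[OF ker_translate(2)[OF ab c(3)] ker_translate(2)[OF cd c(2), unfolded meet_comm[of L c b] meet_comm[of L d b]]]
      by simp
  qed
  ultimately show ?thesis by (auto simp: is_congruence_def equiv_def)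
qed

section \<open>The lattice of congruences\<close>

lemma congruenceD:
  assumes "is_congruence L \<theta>"
  shows "x \<in> carrier L \<Longrightarrow> (x, x) \<in> \<theta>" "(x, y) \<in> \<theta> \<Longrightarrow> (y, x) \<in> \<theta>"
    "(x, y) \<in> \<theta> \<Longrightarrow> (y, z) \<in> \<theta> \<Longrightarrow> (x, z) \<in> \<theta>" "(x, y) \<in> \<theta> \<Longrightarrow> x \<in> carrier L \<and> y \<in> carrier L"
    "(x, y) \<in> \<theta> \<Longrightarrow> c \<in> carrier L \<Longrightarrow> (x \<squnion> c, y \<squnion> c) \<in> \<theta>"
    "(x, y) \<in> \<theta> \<Longrightarrow> c \<in> carrier L \<Longrightarrow> (x \<sqinter> c, y \<sqinter> c) \<in> \<theta>"
proof -
  have e: "equiv (carrier L) \<theta>" using assms by (simp add: is_congruence_def)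
  show r: "x \<in> carrier L \<Longrightarrow> (x, x) \<in> \<theta>" for x using e by (auto simp: equiv_def refl_on_def)
  show "(x, y) \<in> \<theta> \<Longrightarrow> (y, x) \<in> \<theta>" using e by (auto simp: equiv_def dest: symD)
  show "(x, y) \<in> \<theta> \<Longrightarrow> (y, z) \<in> \<theta> \<Longrightarrow> (x, z) \<in> \<theta>" using e by (auto simp: equiv_def dest: transD)
  show "(x, y) \<in> \<theta> \<Longrightarrow> x \<in> carrier L \<and> y \<in> carrier L" using e by (auto simp: equiv_def refl_on_def)
  show "(x, y) \<in> \<theta> \<Longrightarrow> c \<in> carrier L \<Longrightarrow> (x \<squnion> c, y \<squnion> c) \<in> \<theta>"
    "(x, y) \<in> \<theta> \<Longrightarrow> c \<in> carrier L \<Longrightarrow> (x \<sqinter> c, y \<sqinter> c) \<in> \<theta>"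
    using assms r[of c] by (auto simp: is_congruence_def)
qed

text \<open>Adding \<open>u\<close> and then meeting with \<open>v\<close> turns the pair \<open>(x, y)\<close> into \<open>(u, v)\<close>.\<close>

lemma congruence_subinterval:
  assumes \<theta>: "is_congruence L \<theta>" "(x, y) \<in> \<theta>"
    and "x \<sqsubseteq> u" "u \<sqsubseteq> v" "v \<sqsubseteq> y" and uv: "u \<in> carrier L" "v \<in> carrier L"
  shows "(u, v) \<in> \<theta>"
proof -
  note xy = congruenceD(4)[OF \<theta>]
  have "u \<sqsubseteq> y" using le_trans[of u v y] assms xy by blast
  then have "(u, y) \<in> \<theta>" using congruenceD(5)[OF \<theta> uv(1)] join_eq assms xy by simp
  then show ?thesis using congruenceD(6)[OF \<theta>(1) _ uv(2)] meet_eq assms xy by fastforce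
qed

lemma congruence_iff_interval:
  assumes \<theta>: "is_congruence L \<theta>" and c: "x \<in> carrier L" "y \<in> carrier L"
  shows "(x, y) \<in> \<theta> \<longleftrightarrow> (x \<sqinter> y, x \<squnion> y) \<in> \<theta>"
proof
  assume "(x, y) \<in> \<theta>"
  from congruenceD(5,6)[OF \<theta> this c(2)] have "(x \<squnion> y, y) \<in> \<theta>" "(x \<sqinter> y, y) \<in> \<theta>"
    using join_eq[of y y] meet_eq[of y y] c by auto
  then show "(x \<sqinter> y, x \<squnion> y) \<in> \<theta>" using congruenceD(2,3)[OF \<theta>] by blast
next
  assume *: "(x \<sqinter> y, x \<squnion> y) \<in> \<theta>"
  have "(x, x \<squnion> y) \<in> \<theta>"
    by (rule congruence_subinterval[OF \<theta> *]) (use c meet_left join_left in auto)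
  moreover have "(y, x \<squnion> y) \<in> \<theta>"
    by (rule congruence_subinterval[OF \<theta> *]) (use c meet_right join_right in auto)
  ultimately show "(x, y) \<in> \<theta>" using congruenceD(2,3)[OF \<theta>] by blast
qed

text \<open>The pairs of a congruence are determined by its comparable pairs, as \<open>(x, y)\<close> may be replaced by
  \<open>(xy, x + y)\<close>.\<close>

lemma congruence_eqI:
  assumes "is_congruence L \<theta>" "is_congruence L \<psi>"
    and "\<And>x y. \<lbrakk>x \<sqsubseteq> y; x \<in> carrier L; y \<in> carrier L\<rbrakk> \<Longrightarrow> (x, y) \<in> \<theta> \<longleftrightarrow> (x, y) \<in> \<psi>"
  shows "\<theta> = \<psi>"
proof -
  have "(x, y) \<in> \<theta> \<longleftrightarrow> (x, y) \<in> \<psi>" for x y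
  proof (cases "x \<in> carrier L \<and> y \<in> carrier L")
    case True
    then show ?thesis
      using assms(3)[OF meet_le_join[of x y]] congruence_iff_interval[of _ x y] assms(1,2) by simp
  next
    case False
    then show ?thesis using congruenceD(4) assms(1,2) by blast
  qed
  then show ?thesis by auto
qed

lemma congruence_transposed:
  assumes \<theta>: "is_congruence L \<theta>" and pq: "(p, q) \<in> transposition_graph L" and p: "p \<in> \<theta>"
  shows "q \<in> \<theta>"
proof -
  obtain a b c d where ab: "p = (a, b)" "q = (c, d)" "covered_by L a b" "covered_by L c d"
    and t: "(a = b \<sqinter> c \<and> d = b \<squnion> c) \<or> (c = a \<sqinter> d \<and> b = a \<squnion> d)"
    using pq by (cases p; cases q) (auto simp: transposition_graph_def Cov_def)
  note car = covered_byD(1,2)[OF ab(3)] covered_byD(1,2)[OF ab(4)]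
  show ?thesis using t
  proof
    assume t: "a = b \<sqinter> c \<and> d = b \<squnion> c"
    then have "a \<squnion> c = c" using join_eq[of a c] meet_right[of b c] car by simp
    then show ?thesis using congruenceD(5)[OF \<theta> _ car(3), of a b] p t ab by simp
  next
    assume t: "c = a \<sqinter> d \<and> b = a \<squnion> d"
    then have "b \<sqinter> d = d" using meet_eq[of d b] join_right[of a d] car by simp
    then show ?thesis using congruenceD(6)[OF \<theta> _ car(4), of a b] p t ab by simp
  qed
qed

lemma congruence_proj_class:
  assumes "is_congruence L \<theta>" "proj_class p = proj_class q" "p \<in> \<theta>"
  shows "q \<in> \<theta>"
proof -
  have "(p, q) \<in> (transposition_graph L)\<^sup>*" using assms(2) proj_class_eq_iff by simp
  then show ?thesis
    by (induction rule: rtrancl_induct) (use assms(1,3) congruence_transposed in blast)+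
qed

text \<open>The classes outside \<open>T\<close> are those of the collapsed coverings. An interval is collapsed by \<open>\<theta>\<close>
  iff all its coverings are, by transitivity along a maximal chain, and this holds iff \<open>val T\<close> does not
  increase on it.\<close>

lemma congruence_eq_ker:
  assumes \<theta>: "is_congruence L \<theta>"
  shows "\<theta> = ker (proj_class ` (Cov L - \<theta>))" (is "_ = ker ?T")
proof (rule congruence_eqI[OF \<theta> ker_congruence])
  fix x y assume xy: "x \<sqsubseteq> y" "x \<in> carrier L" "y \<in> carrier L"
  have T: "proj_class (u, v) \<in> ?T \<longleftrightarrow> (u, v) \<notin> \<theta>" if "covered_by L u v" for u v
  proof
    assume "proj_class (u, v) \<in> ?T"
    then obtain q where "q \<notin> \<theta>" "proj_class (u, v) = proj_class q" by blast
    then show "(u, v) \<notin> \<theta>" using congruence_proj_class[OF \<theta>] by blast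
  qed (use that in \<open>auto simp: Cov_def\<close>)
  show "(x, y) \<in> \<theta> \<longleftrightarrow> (x, y) \<in> ker ?T"
  proof
    assume *: "(x, y) \<in> \<theta>"
    have "val ?T x = val ?T y"
      using xy
    proof (rule interval_induct)
      fix u v assume uv: "x \<sqsubseteq> u" "v \<sqsubseteq> y" "covered_by L u v" and IH: "val ?T x = val ?T u"
      have "(u, v) \<in> \<theta>"
        using congruence_subinterval[OF \<theta> * uv(1) _ uv(2)] covered_byD(1-3)[OF uv(3)] by simp
      then show "val ?T x = val ?T v" using IH T[OF uv(3)] val_covered_by[OF uv(3), of ?T] by simp
    qed simp
    then show "(x, y) \<in> ker ?T" using ker_le_iff xy by simp
  next
    assume "(x, y) \<in> ker ?T"
    then have eq: "val ?T x = val ?T y" using ker_le_iff xy by simp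
    show "(x, y) \<in> \<theta>"
      using xy
    proof (rule interval_induct)
      fix u v assume uv: "x \<sqsubseteq> u" "v \<sqsubseteq> y" "covered_by L u v" and IH: "(x, u) \<in> \<theta>"
      have "val ?T x \<le> val ?T u" "val ?T v \<le> val ?T y"
        using val_mono uv xy covered_byD(1,2)[OF uv(3)] by auto
      then have "(u, v) \<in> \<theta>"
        using eq T[OF uv(3)] val_covered_by[OF uv(3), of ?T] by (auto split: if_splits)
      then show "(x, v) \<in> \<theta>" using IH congruenceD(3)[OF \<theta>] by blast
    qed (use congruenceD(1)[OF \<theta>] xy in blast)
  qed
qed

text \<open>A class in \<open>T' - T\<close> is that of a covering collapsed by \<open>ker T\<close> and not by \<open>ker T'\<close>. If
  \<open>T' \<subseteq> T\<close>, then \<open>val T\<close> is the sum of the isotone functions \<open>val T'\<close> and \<open>val (T - T')\<close>, so it is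
  constant on an interval only if \<open>val T'\<close> is.\<close>

lemma ker_subset_iff:
  assumes "T \<subseteq> proj_classes L" "T' \<subseteq> proj_classes L"
  shows "ker T \<subseteq> ker T' \<longleftrightarrow> T' \<subseteq> T"
proof
  assume *: "ker T \<subseteq> ker T'"
  show "T' \<subseteq> T"
  proof
    fix P assume P: "P \<in> T'"
    then obtain a b where ab: "covered_by L a b" "P = proj_class (a, b)"
      using assms(2) proj_classes_iff by blast
    have "(a, b) \<in> ker S \<longleftrightarrow> P \<notin> S" for S
      using ker_le_iff[OF covered_byD(3,1,2)[OF ab(1)]] val_covered_by[OF ab(1), of S] ab(2) by simp
    then show "P \<in> T" using * P by blast
  qed
next
  assume sub: "T' \<subseteq> T"
  have split: "val T x = val T' x + val (T - T') x" for x
  proof -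
    have "filter_mset (\<lambda>P. P \<in> T) (factors x)
        = filter_mset (\<lambda>P. P \<in> T') (factors x) + filter_mset (\<lambda>P. P \<in> T - T') (factors x)"
      by (rule multiset_eqI) (use sub in auto)
    then show ?thesis by (simp add: val_def)
  qed
  show "ker T \<subseteq> ker T'"
  proof
    fix p assume p: "p \<in> ker T"
    obtain x y where [simp]: "p = (x, y)" by (cases p)
    note k = kerD(1-3)[OF p[unfolded \<open>p = (x, y)\<close>]]
    have "val S (x \<sqinter> y) \<le> val S (x \<squnion> y)" for S using val_mono meet_le_join k by simp
    from this[of T'] this[of "T - T'"] have "val T' (x \<sqinter> y) = val T' (x \<squnion> y)"
      using k(3) split by simp
    then show "p \<in> ker T'" using k by (simp add: ker_def)
  qed
qed

lemma proj_class_in_proj_classes: "covered_by L a b \<Longrightarrow> proj_class (a, b) \<in> proj_classes L"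
  using proj_classes_iff by blast

lemma congruence_is_ker:
  assumes "is_congruence L \<theta>"
  shows "\<exists>T \<subseteq> proj_classes L. \<theta> = ker T"
  using congruence_eq_ker[OF assms] proj_class_in_proj_classes
  by (intro exI[of _ "proj_class ` (Cov L - \<theta>)"]) (auto simp: Cov_def)

text \<open>Every class is met by every maximal chain from \<open>0\<close> to \<open>1\<close>: a chain through a covering of the
  class meets it, and all these chains have the same factors.\<close>

lemma finite_proj_classes: "finite (proj_classes L)"
proof (rule finite_subset)
  show "proj_classes L \<subseteq> set_mset (factors \<top>)"
  proof
    fix P assume "P \<in> proj_classes L"
    then obtain a b where ab: "covered_by L a b" "P = proj_class (a, b)" using proj_classes_iff by blast
    have "factors b \<subseteq># factors \<top>" using factors_mono covered_byD(2)[OF ab(1)] by simp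
    then show "P \<in># factors \<top>" using factors_covered_by[OF ab(1)] ab(2) mset_subset_eqD by fastforce
  qed
qed simp

lemma factors_subset:
  assumes "x \<in> carrier L"
  shows "set_mset (factors x) \<subseteq> proj_classes L"
proof (rule interval_induct[OF bottom_lower bottom_closed, OF assms assms])
  fix u v assume "covered_by L u v" "set_mset (factors u) \<subseteq> proj_classes L"
  then show "set_mset (factors v) \<subseteq> proj_classes L"
    using factors_covered_by[of u v] proj_class_in_proj_classes[of u v] by simp
qed (simp add: factors_bottom)

text \<open>Since \<open>ker\<close> reverses inclusion, the isomorphism takes complements first: \<open>S\<close> is the set of the
  collapsed classes.\<close>

lemma Con_powerset:
  "bij_betw (\<lambda>S. ker (proj_classes L - S)) (Pow (proj_classes L)) (carrier (Con L))"
  "\<lbrakk>S \<subseteq> proj_classes L; S' \<subseteq> proj_classes L\<rbrakk>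
    \<Longrightarrow> ker (proj_classes L - S) \<sqsubseteq>\<^bsub>Con L\<^esub> ker (proj_classes L - S') \<longleftrightarrow> S \<subseteq> S'"
proof -
  show *: "ker (proj_classes L - S) \<sqsubseteq>\<^bsub>Con L\<^esub> ker (proj_classes L - S') \<longleftrightarrow> S \<subseteq> S'"
    if "S \<subseteq> proj_classes L" "S' \<subseteq> proj_classes L" for S S'
    using ker_subset_iff[of "proj_classes L - S" "proj_classes L - S'"] that by (auto simp: Con_def)
  show "bij_betw (\<lambda>S. ker (proj_classes L - S)) (Pow (proj_classes L)) (carrier (Con L))"
  proof (rule bij_betwI')
    fix S S' assume "S \<in> Pow (proj_classes L)" "S' \<in> Pow (proj_classes L)"
    then show "(ker (proj_classes L - S) = ker (proj_classes L - S')) = (S = S')"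
      using *[of S S'] *[of S' S] by (auto simp: Con_def)
  next
    fix \<theta> assume "\<theta> \<in> carrier (Con L)"
    then obtain T where "T \<subseteq> proj_classes L" "\<theta> = ker T"
      using congruence_is_ker by (auto simp: Con_def)
    then show "\<exists>S\<in>Pow (proj_classes L). \<theta> = ker (proj_classes L - S)"
      by (intro bexI[of _ "proj_classes L - T"]) (auto simp: double_diff)
  qed (simp add: Con_def ker_congruence)
qed

lemma Con_structure:
  "boolean_lattice (Con L)" "finite_length (Con L)" "lat_length (Con L) = card (proj_classes L)"
  "coatoms (Con L) = (\<lambda>P. ker {P}) ` proj_classes L"
proof -
  have "(.=\<^bsub>Con L\<^esub>) = (=)" by (simp add: Con_def)
  note ps = powerset_isomorphic[OF finite_proj_classes this Con_powerset]
  show "boolean_lattice (Con L)" "finite_length (Con L)" "lat_length (Con L) = card (proj_classes L)"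
    by (rule ps; assumption)+
  have "(\<lambda>P. ker (proj_classes L - (proj_classes L - {P}))) ` proj_classes L = (\<lambda>P. ker {P}) ` proj_classes L"
    by (rule image_cong) (auto simp: double_diff)
  then show "coatoms (Con L) = (\<lambda>P. ker {P}) ` proj_classes L" using ps(4) by simp
qed

lemma inj_ker_singleton: "inj_on (\<lambda>P. ker {P}) (proj_classes L)"
  using ker_subset_iff[of "{P}" "{P'}" for P P'] by (intro inj_onI) auto

section \<open>Lengths of the lattice and of its quotients\<close>

text \<open>Along a maximal chain \<open>val T\<close> increases by \<open>0\<close> or \<open>1\<close> at each step, so it omits no value.\<close>

lemma val_chain:
  assumes "x \<in> carrier L"
  shows "\<exists>C. is_chain L C \<and> (\<forall>y\<in>C. y \<sqsubseteq> x) \<and> val T ` C = {..val T x}"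
proof (rule interval_induct[OF bottom_lower bottom_closed, OF assms assms])
  show "\<exists>C. is_chain L C \<and> (\<forall>y\<in>C. y \<sqsubseteq> \<bottom>) \<and> val T ` C = {..val T \<bottom>}"
    by (intro exI[of _ "{\<bottom>}"]) (auto simp: is_chain_def val_bottom)
next
  fix u v assume uv: "covered_by L u v"
    and "\<exists>C. is_chain L C \<and> (\<forall>y\<in>C. y \<sqsubseteq> u) \<and> val T ` C = {..val T u}"
  then obtain C where C: "is_chain L C" "\<And>y. y \<in> C \<Longrightarrow> y \<sqsubseteq> u" "val T ` C = {..val T u}" by blast
  note c = covered_byD(1-3)[OF uv]
  have car: "y \<in> carrier L" if "y \<in> C" for y using C(1) that by (auto simp: is_chain_def)
  have le: "y \<sqsubseteq> v" if "y \<in> C" for y by (rule le_trans[OF C(2)[OF that] c(3) car[OF that] c(1,2)])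
  have "val T ` insert v C = {..val T v}"
    using C(3) val_covered_by[OF uv, of T] by (auto simp: atMost_Suc)
  moreover have "is_chain L (insert v C)" using C(1) le c by (auto simp: is_chain_def)
  ultimately show "\<exists>C. is_chain L C \<and> (\<forall>y\<in>C. y \<sqsubseteq> v) \<and> val T ` C = {..val T v}"
    using le c by (intro exI[of _ "insert v C"]) auto
qed

lemma lat_length_eq: "lat_length L = val UNIV \<top>"
proof -
  obtain C where "is_chain L C" "val UNIV ` C = {..val UNIV \<top>}" using val_chain[of \<top>] by blast
  then show ?thesis
    by (intro lat_length_eqI(2)[of L "val UNIV"]) (auto intro: val_mono val_strict_mono)
qed

text \<open>The elements of a class of \<open>ker T\<close> have the same value, which gives a strictly increasing function
  on the quotient; the image of a chain on which all values occur attains its maximum.\<close>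

lemma quotient_length:
  "finite_length (quotient_lattice L (ker T))" "lat_length (quotient_lattice L (ker T)) = val T \<top>"
proof -
  let ?Q = "quotient_lattice L (ker T)"
  let ?c = "\<lambda>x. ker T `` {x}"
  have cl: "carrier ?Q = ?c ` carrier L"
    by (auto simp: quotient_lattice_def quotient_def)
  have self: "x \<in> ?c x" if "x \<in> carrier L" for x using that by (simp add: ker_le_iff)
  \<comment> \<open>The choice is immaterial, because \<open>val T\<close> is constant on classes.\<close>
  define h where "h = (\<lambda>A. val T (SOME x. x \<in> A))"
  have h: "h (?c x) = val T x" if "x \<in> carrier L" for x
  proof -
    have "(SOME y. y \<in> ?c x) \<in> ?c x" by (rule someI[of _ x]) (rule self[OF that])
    then have "(x, SOME y. y \<in> ?c x) \<in> ker T" by blast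
    from kerD(4,5)[OF this] show ?thesis by (simp add: h_def)
  qed
  have mono: "h A < h B" if AB: "A \<in> carrier ?Q" "B \<in> carrier ?Q" "A \<sqsubseteq>\<^bsub>?Q\<^esub> B" "A \<noteq> B" for A B
  proof -
    obtain x y where xy: "A = ?c x" "B = ?c y" "x \<in> carrier L" "y \<in> carrier L" using AB(1,2) by (auto simp: cl)
    have "x \<sqinter> y \<in> ?c x" using AB(3) self xy by (simp add: quotient_lattice_def)
    then have "(x, x \<sqinter> y) \<in> ker T" by simp
    from kerD(4,5)[OF this] have m: "val T (x \<sqinter> y) = val T x" by simp
    have "val T (x \<sqinter> y) \<le> val T y" using xy by (auto intro: val_mono meet_right)
    moreover have "val T x \<noteq> val T y"
    proof
      assume "val T x = val T y"
      then have "(x, y) \<in> ker T" using m val_modular[OF xy(3,4), of T] xy by (simp add: ker_def)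
      then have "?c x = ?c y"
        using ker_congruence[of T] by (intro equiv_class_eq) (auto simp: is_congruence_def)
      then show False using AB xy by simp
    qed
    ultimately show ?thesis using h xy m by simp
  qed
  have bound: "h A \<le> val T \<top>" if "A \<in> carrier ?Q" for A
    using that h by (auto simp: cl intro!: val_mono)
  obtain C where C: "is_chain L C" "val T ` C = {..val T \<top>}" using val_chain[of \<top>] by blast
  have car: "x \<in> carrier L" if "x \<in> C" for x using C(1) that by (auto simp: is_chain_def)
  have le: "?c x \<sqsubseteq>\<^bsub>?Q\<^esub> ?c y" if "x \<sqsubseteq> y" "x \<in> carrier L" "y \<in> carrier L" for x y
  proof -
    have "(x, a \<sqinter> b) \<in> ker T" if "(x, a) \<in> ker T" "(y, b) \<in> ker T" for a b
    proof -
      have "(x \<sqinter> y, a \<sqinter> b) \<in> ker T"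
        using ker_congruence[of T] that unfolding is_congruence_def by blast
      then show ?thesis using meet_eq \<open>x \<sqsubseteq> y\<close> \<open>x \<in> carrier L\<close> \<open>y \<in> carrier L\<close> by simp
    qed
    then show ?thesis by (simp add: quotient_lattice_def)
  qed
  have C': "is_chain ?Q (?c ` C)"
    unfolding is_chain_def
  proof (intro conjI ballI)
    show "?c ` C \<subseteq> carrier ?Q" using car cl by auto
    fix A B assume "A \<in> ?c ` C" "B \<in> ?c ` C"
    then obtain x y where xy: "x \<in> C" "y \<in> C" "A = ?c x" "B = ?c y" by auto
    then have "x \<sqsubseteq> y \<or> y \<sqsubseteq> x" using C(1) by (auto simp: is_chain_def)
    then show "A \<sqsubseteq>\<^bsub>?Q\<^esub> B \<or> B \<sqsubseteq>\<^bsub>?Q\<^esub> A" using le car xy by blast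
  qed
  have hC: "h ` ?c ` C = {..val T \<top>}" using C(2) h car by (simp add: image_image cong: image_cong_simp)
  show "finite_length ?Q" "lat_length ?Q = val T \<top>"
    using lat_length_eqI[OF mono bound C' hC] by auto
qed

lemma val_singleton: "val {P} x = count (factors x) P"
  by (simp add: val_def count_conv_size_mset)

lemma val_UNIV_eq_sum:
  assumes "x \<in> carrier L"
  shows "val UNIV x = (\<Sum>P\<in>proj_classes L. val {P} x)"
proof -
  have "val UNIV x = (\<Sum>P\<in>set_mset (factors x). count (factors x) P)"
    by (simp add: val_def size_multiset_overloaded_eq)
  also have "\<dots> = (\<Sum>P\<in>proj_classes L. count (factors x) P)"
    using factors_subset[OF assms] finite_proj_classes
    by (intro sum.mono_neutral_left) (auto simp: not_in_iff)
  finally show ?thesis by (simp add: val_singleton)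
qed

text \<open>The coverings of a maximal chain are distinct, because the \<open>k\<close>-th element has exactly \<open>k\<close> factors.
  Hence counting them as a set agrees with counting their classes in the multiset.\<close>

lemma card_chain_coverings:
  assumes xs: "is_maximal_chain L xs" and P: "P \<in> proj_classes L"
  shows "card (chain_coverings xs \<inter> P) = count (factors \<top>) P"
proof -
  have x0: "xs ! 0 = \<bottom>" "xs \<noteq> []" "xs ! (length xs - 1) = \<top>"
    using xs by (auto simp: is_maximal_chain_def hd_conv_nth last_conv_nth)
  have cov: "covered_by L (xs ! i) (xs ! Suc i)" if "Suc i < length xs" for i
    using xs that by (simp add: is_maximal_chain_def)
  let ?D = "\<lambda>k. (\<lambda>i. (xs ! i, xs ! Suc i)) ` {..<k}"
  have "k < length xs \<Longrightarrow> size (factors (xs ! k)) = k \<and> card (?D k \<inter> P) = count (factors (xs ! k)) P"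
    for k
  proof (induction k)
    case 0
    then show ?case using x0 factors_bottom by simp
  next
    case (Suc k)
    note f = factors_covered_by[OF cov[OF Suc.prems]]
    have size: "size (factors (xs ! i)) = i" if "i \<le> k" for i
      using that
    proof (induction i)
      case 0
      then show ?case using x0 factors_bottom by simp
    next
      case (Suc i)
      then show ?case using factors_covered_by[OF cov[of i]] \<open>Suc k < length xs\<close> by simp
    qed
    have new: "(xs ! k, xs ! Suc k) \<notin> ?D k" 
    proof
      assume "(xs ! k, xs ! Suc k) \<in> ?D k"
      then obtain i where "i < k" "xs ! k = xs ! i" by auto
      then show False using size[of i] size[of k] by simp
    qed
    have "?D (Suc k) \<inter> P = (if (xs ! k, xs ! Suc k) \<in> P then insert (xs ! k, xs ! Suc k) (?D k \<inter> P) else ?D k \<inter> P)"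
      by (auto simp: lessThan_Suc)
    then have "card (?D (Suc k) \<inter> P) = (if (xs ! k, xs ! Suc k) \<in> P then 1 else 0) + card (?D k \<inter> P)"
      using new by simp
    then show ?case
      using Suc f mem_proj_class_iff[OF P, of "xs ! k" "xs ! Suc k"] by auto
  qed
  from this[of "length xs - 1"] have "card (?D (length xs - 1) \<inter> P) = count (factors \<top>) P"
    using x0 by simp
  moreover have "chain_coverings xs = ?D (length xs - 1)"
    unfolding chain_coverings_def by (auto simp: less_diff_conv image_iff)
  ultimately show ?thesis by simp
qed

section \<open>The subdirect representation\<close>

text \<open>The congruences properly above \<open>ker T\<close> are the \<open>ker U\<close> with \<open>U \<subset> T\<close>, so a least one amounts to
  a greatest proper subset of \<open>T\<close>. If there is one, \<open>U\<close>, and \<open>P \<in> T - U\<close>, then \<open>{P}\<close> is not contained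
  in \<open>U\<close> and so is not a proper subset of \<open>T\<close>.\<close>

lemma quotient_subdirectly_irreducible_iff:
  assumes T: "T \<subseteq> proj_classes L"
  shows "subdirectly_irreducible (quotient_lattice L (ker T)) \<longleftrightarrow> (\<exists>P. T = {P})"
proof -
  have lat: "lattice L" by unfold_locales
  have psub: "ker T \<subset> ker U \<longleftrightarrow> U \<subset> T" if "U \<subseteq> proj_classes L" for U
    using ker_subset_iff[OF T that] ker_subset_iff[OF that T] by blast
  note ex = congruence_is_ker
  show ?thesis
    unfolding subdirectly_irreducible_quotient_iff[OF lat ker_congruence]
  proof
    assume "\<exists>\<mu>. is_congruence L \<mu> \<and> ker T \<subset> \<mu> \<and> (\<forall>\<chi>. is_congruence L \<chi> \<longrightarrow> ker T \<subset> \<chi> \<longrightarrow> \<mu> \<subseteq> \<chi>)"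
    then obtain U where U: "U \<subseteq> proj_classes L" "U \<subset> T"
      and min: "\<And>\<chi>. is_congruence L \<chi> \<Longrightarrow> ker T \<subset> \<chi> \<Longrightarrow> ker U \<subseteq> \<chi>"
      using ex psub by metis
    then obtain P where P: "P \<in> T" "P \<notin> U" by blast
    have P1: "{P} \<subseteq> proj_classes L" using P T by blast
    have "T = {P}"
    proof (rule ccontr)
      assume "T \<noteq> {P}"
      then have "ker T \<subset> ker {P}" using psub[OF P1] P by blast
      then have "ker U \<subseteq> ker {P}" using min ker_congruence by blast
      then show False using ker_subset_iff[OF U(1) P1] P by blast
    qed
    then show "\<exists>P. T = {P}" by blast
  next
    assume "\<exists>P. T = {P}"
    then obtain P where P: "T = {P}" by blast
    have "ker {} \<subseteq> \<chi>" if \<chi>: "is_congruence L \<chi>" "ker T \<subset> \<chi>" for \<chi>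
    proof -
      obtain U where U: "U \<subseteq> proj_classes L" "\<chi> = ker U" using ex[OF \<chi>(1)] by blast
      then have "U \<subset> {P}" using psub \<chi>(2) P by blast
      then have "U = {}" by blast
      then show ?thesis using U by simp
    qed
    moreover have "ker T \<subset> ker {}" using psub[of "{}"] P by blast
    ultimately show "\<exists>\<mu>. is_congruence L \<mu> \<and> ker T \<subset> \<mu> \<and> (\<forall>\<chi>. is_congruence L \<chi> \<longrightarrow> ker T \<subset> \<chi> \<longrightarrow> \<mu> \<subseteq> \<chi>)"
      using ker_congruence by blast
  qed
qed

text \<open>Injectivity is the only issue: elements identified by every \<open>ker {P}\<close> have a meet and a join with
  the same multiplicity of every class, hence of the same total value, hence equal.\<close>

lemma subdirect_embedding_kernels:
  defines "I \<equiv> (\<lambda>P. ker {P}) ` proj_classes L"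
  shows "subdirect_embedding L I (quotient_lattice L) (\<lambda>x. \<lambda>\<theta>\<in>I. \<theta> `` {x})"
proof -
  let ?f = "\<lambda>x. \<lambda>\<theta>\<in>I. \<theta> `` {x}"
  let ?\<Pi> = "product_lattice I (quotient_lattice L)"
  have lat: "lattice L" by unfold_locales
  have cong: "is_congruence L \<theta>" if "\<theta> \<in> I" for \<theta> using that ker_congruence by (auto simp: I_def)
  note ops = quotient_lattice_operations[OF lat cong]
  note prod = product_lattice_operations[of I "quotient_lattice L", OF ops(1), simplified]
  have f: "?f x \<in> carrier ?\<Pi>" if "x \<in> carrier L" for x
    using that by (auto simp: product_lattice_def quotient_lattice_def quotient_def)
  have inj: "inj_on ?f (carrier L)"
  proof (rule inj_onI)
    fix x y assume xy: "x \<in> carrier L" "y \<in> carrier L" and eq: "?f x = ?f y"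
    have "count (factors (x \<sqinter> y)) P = count (factors (x \<squnion> y)) P" for P
    proof (cases "P \<in> proj_classes L")
      case True
      then have "ker {P} \<in> I" by (simp add: I_def)
      then have "ker {P} `` {x} = ker {P} `` {y}" using fun_cong[OF eq, of "ker {P}"] by simp
      moreover have "(y, y) \<in> ker {P}" using xy by (simp add: ker_le_iff)
      ultimately have "(x, y) \<in> ker {P}" by blast
      then show ?thesis using kerD(3) by (simp add: val_singleton[symmetric])
    next
      case False
      then have "P \<notin># factors z" if "z \<in> carrier L" for z using factors_subset that by blast
      then have "count (factors z) P = 0" if "z \<in> carrier L" for z
        using that by (simp add: count_eq_zero_iff)
      then show ?thesis using xy by simp
    qed
    then have "factors (x \<sqinter> y) = factors (x \<squnion> y)" by (rule multiset_eqI)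
    then have "val UNIV (x \<sqinter> y) = val UNIV (x \<squnion> y)" by (simp add: val_def)
    then have "x \<sqinter> y = x \<squnion> y" using val_strict_mono[OF meet_le_join[OF xy]] xy by force
    then show "x = y"
      using le_antisym[of x y] le_antisym[of x "x \<squnion> y"] le_antisym[of y "x \<squnion> y"] xy
        meet_left[OF xy] meet_right[OF xy] join_left[OF xy] join_right[OF xy] by simp
  qed
  have J: "?f (x \<squnion> y) = ?f x \<squnion>\<^bsub>?\<Pi>\<^esub> ?f y" if "x \<in> carrier L" "y \<in> carrier L" for x y
    unfolding prod(2)[OF f[OF that(1)] f[OF that(2)]]
    by (rule restrict_ext) (simp add: ops(2) that)
  have M: "?f (x \<sqinter> y) = ?f x \<sqinter>\<^bsub>?\<Pi>\<^esub> ?f y" if "x \<in> carrier L" "y \<in> carrier L" for x y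
    unfolding prod(3)[OF f[OF that(1)] f[OF that(2)]]
    by (rule restrict_ext) (simp add: ops(3) that)
  have "(\<lambda>x. ?f x \<theta>) ` carrier L = carrier (quotient_lattice L \<theta>)" if "\<theta> \<in> I" for \<theta>
    using that by (auto simp: quotient_lattice_def quotient_def)
  then show ?thesis
    unfolding subdirect_embedding_def join_pres_def meet_pres_def
    using f inj J M lat prod(1) by auto
qed

end

theorem theorem3p3:
  fixes L :: "('a, 'm) gorder_scheme"
  assumes "modular_lattice L" and "carrier L \<noteq> {}" and "finite_length L"
  shows
    "\<comment> \<open>(i)\<close>
     (finite (proj_classes L) \<and>
      boolean_lattice (Con L) \<and>
      finite_length (Con L) \<and>
      lat_length (Con L) = card (proj_classes L)) \<and>
     \<comment> \<open>(ii)\<close>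
     (finite (coatoms (Con L)) \<and>
      card (coatoms (Con L)) = card (proj_classes L) \<and>
      subdirect_embedding L (coatoms (Con L)) (quotient_lattice L)
        (\<lambda>x. \<lambda>\<theta>\<in>coatoms (Con L). \<theta> `` {x}) \<and>
      (\<forall>\<theta>\<in>carrier (Con L).
        subdirectly_irreducible (quotient_lattice L \<theta>) \<longleftrightarrow> \<theta> \<in> coatoms (Con L)) \<and>
      (\<forall>\<theta>\<in>coatoms (Con L). finite_length (quotient_lattice L \<theta>)) \<and>
      lat_length L = (\<Sum>\<theta>\<in>coatoms (Con L). lat_length (quotient_lattice L \<theta>))) \<and>
     \<comment> \<open>(iii)\<close>
     (\<forall>P\<in>proj_classes L. \<forall>xs ys.
        is_maximal_chain L xs \<and> is_maximal_chain L ys \<longrightarrow>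
        card (chain_coverings xs \<inter> P) = card (chain_coverings ys \<inter> P))"
proof -
  interpret finite_length_modular_lattice L
    using assms by (intro finite_length_modular_lattice.intro finite_length_modular_lattice_axioms.intro)
  have irr: "subdirectly_irreducible (quotient_lattice L \<theta>) \<longleftrightarrow> \<theta> \<in> coatoms (Con L)"
    if \<theta>: "\<theta> \<in> carrier (Con L)" for \<theta>
  proof -
    obtain T where T: "T \<subseteq> proj_classes L" "\<theta> = ker T"
      using \<theta> congruence_is_ker by (auto simp: Con_def)
    have "ker T \<in> coatoms (Con L) \<longleftrightarrow> (\<exists>P. T = {P})"
    proof
      assume "ker T \<in> coatoms (Con L)"
      then obtain P where P: "{P} \<subseteq> proj_classes L" "ker T = ker {P}" by (auto simp: Con_structure(4))
      then have "T = {P}"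
        using ker_subset_iff[OF T(1) P(1)] ker_subset_iff[OF P(1) T(1)] by (intro subset_antisym) simp_all
      then show "\<exists>P. T = {P}" by blast
    qed (use T in \<open>auto simp: Con_structure(4)\<close>)
    then show ?thesis using quotient_subdirectly_irreducible_iff[OF T(1)] T(2) by simp
  qed
  have len: "lat_length L = (\<Sum>\<theta>\<in>coatoms (Con L). lat_length (quotient_lattice L \<theta>))"
    by (simp add: lat_length_eq val_UNIV_eq_sum Con_structure(4) sum.reindex[OF inj_ker_singleton]
        quotient_length(2))
  show ?thesis
  proof (intro conjI ballI allI impI)
    show "card (chain_coverings xs \<inter> P) = card (chain_coverings ys \<inter> P)"
      if "P \<in> proj_classes L" "is_maximal_chain L xs \<and> is_maximal_chain L ys" for P xs ys
      using card_chain_coverings that by simp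
    show "card (coatoms (Con L)) = card (proj_classes L)"
      unfolding Con_structure(4) by (rule card_image[OF inj_ker_singleton])
    show "finite_length (quotient_lattice L \<theta>)" if "\<theta> \<in> coatoms (Con L)" for \<theta>
      using that quotient_length(1) by (auto simp: Con_structure(4))
    show "subdirect_embedding L (coatoms (Con L)) (quotient_lattice L)
        (\<lambda>x. \<lambda>\<theta>\<in>coatoms (Con L). \<theta> `` {x})"
      unfolding Con_structure(4) by (rule subdirect_embedding_kernels)
  qed (use finite_proj_classes Con_structure irr len in auto)
qed

end
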